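(* For every integer $d\ge 1$ and every finite constant $K>0$ there exist positive constants $A$, $B$, $C$ depending only on $d$ and $K$ such that the following holds. Let $n\ge 2$, let $\mathbf{x}_1,\ldots,\mathbf{x}_n\in\mathbb{R}^d$ be deterministic, let $m:\mathbb{R}^d\to\mathbb{R}$ be measurable, let $\epsilon_1,\ldots,\epsilon_n$ be i.i.d. copies of a mean-zero random variable $\epsilon$ with $\mathbb{E}[\exp(\epsilon^2/K)]\le 2$, and let $y_i=\mu_i+\epsilon_i$ with $\mu_i=m(\mathbf{x}_i)$ and $\boldsymbol{\mu}=(\mu_1,\ldots,\mu_n)$. Let $\mathrm{MSE}(\cdot)$, $f(\cdot)$, $k^*=\operatorname{argmin}_{1\le k\le n-1}\mathrm{MSE}(k)$ and $\tilde k=\operatorname{argmin}_{1\le k\le n-1} f(k)$ be as defined in the context. Then for every $t\ge 0$, $$\mathbb{P}\bigl(|\mathrm{MSE}(k^* )-\mathrm{MSE}(\tilde k)|\ge t\bigr)\le 4n\exp\bigl(-n\min\{At^2,Bt\}\bigr)+4n\exp\bigl(-Cn^2t^2/\|\boldsymbol{\mu}\|^2\bigr).$$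
   Context: For each $i\in\{1,\ldots,n\}$ and $1\le k\le n-1$, $N_k(i)$ denotes the set of indices of the $k$ nearest neighbors (in Euclidean distance) of $\mathbf{x}_i$ among $\mathbf{x}_1,\ldots,\mathbf{x}_{i-1},\mathbf{x}_{i+1},\ldots,\mathbf{x}_n$, where ties are broken at random; thus $|N_k(i)|=k$ and $i\notin N_k(i)$. Define the leave-one-out $k$-nearest-neighbor estimate $$\hat m_{k,n}(\mathbf{x}_i):=\frac1k\sum_{j\in N_k(i)}y_j,$$ the mean squared error $$\mathrm{MSE}(k):=\mathbb{E}\Bigl[\frac1n\sum_{i=1}^n\bigl(m(\mathbf{x}_i)-\hat m_{k,n}(\mathbf{x}_i)\bigr)^2\Bigr],$$ where the expectation is taken over the $\epsilon_i$'s, and the leave-one-out cross-validation criterion $$f(k):=\frac1n\sum_{i=1}^n\Bigl(y_i-\frac1k\sum_{j\in N_k(i)}y_j\Bigr)^2.$$ The number $k^*$ is a minimizer of $\mathrm{MSE}(k)$ over $1\le k\le n-1$. The number $\tilde k$ is a minimizer of $f(k)$ over $1\le k\le n-1$; it is random, being computed from the data, and $\mathrm{MSE}(\tilde k)$ means the function $k\mapsto\mathrm{MSE}(k)$ evaluated at $k=\tilde k$. $\|\cdot\|$ is the Euclidean norm. If $\boldsymbol{\mu}=0$ and $t>0$, the term $\exp(-Cn^2t^2/\|\boldsymbol{\mu}\|^2)$ is read as $0$; if $\boldsymbol{\mu}=0$ and $t=0$, it is read as $1$. *)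

theory Defs
  imports "HOL-Probability.Probability"
begin

text \<open>
  The points are \<open>x 1, \<dots>, x n\<close>; values of index functions outside \<open>{1..n}\<close> are never used.

  Random tie-breaking follows the usual randomization of nearest-neighbor rules: every index \<open>j\<close>
  receives a uniform random number \<open>u j\<close>, and among points equidistant from \<open>x i\<close> the index \<open>j\<close>
  with the smaller \<open>\<bar>u j - u i\<bar>\<close> comes first.  Since the \<open>u j\<close> are i.i.d., for every \<open>i\<close> the tied
  indices are ranked uniformly at random.  Two indices with the same \<open>\<bar>u j - u i\<bar>\<close> (an
  event of probability zero) are compared by index, so that \<open>card (N_k(i)) = k\<close> for every \<open>u\<close>.
\<close>

definition nearer :: "(nat \<Rightarrow> 'a::metric_space) \<Rightarrow> (nat \<Rightarrow> real) \<Rightarrow> nat \<Rightarrow> nat \<Rightarrow> nat \<Rightarrow> bool" where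
  "nearer x u i j l \<longleftrightarrow>
     dist (x i) (x j) < dist (x i) (x l) \<or>
     dist (x i) (x j) = dist (x i) (x l) \<and>
       (\<bar>u j - u i\<bar> < \<bar>u l - u i\<bar> \<or> \<bar>u j - u i\<bar> = \<bar>u l - u i\<bar> \<and> j < l)"

definition knn_set :: "nat \<Rightarrow> (nat \<Rightarrow> 'a::metric_space) \<Rightarrow> (nat \<Rightarrow> real) \<Rightarrow> nat \<Rightarrow> nat \<Rightarrow> nat set" where
  "knn_set n x u k i =
     {j \<in> {1..n} - {i}. card {l \<in> {1..n} - {i}. nearer x u i l j} < k}"

lemma knn_set_subset: "knn_set n x u k i \<subseteq> {1..n} - {i}"
  by (auto simp: knn_set_def)

lemma card_knn_set:
  assumes "i \<in> {1..n}" and "k \<le> n - 1"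
  shows "card (knn_set n x u k i) = k"
proof -
  define S where "S = {1..n} - {i}"
  define r where "r j = card {l \<in> S. nearer x u i l j}" for j
  have fin: "finite S" and cS: "card S = n - 1"
    using assms(1) by (auto simp: S_def)
  have mono: "r a < r b" if "a \<in> S" "nearer x u i a b" for a b
    unfolding r_def
  proof (rule psubset_card_mono)
    show "finite {l \<in> S. nearer x u i l b}" using fin by simp
    have "\<not> nearer x u i a a" by (auto simp: nearer_def)
    moreover have "nearer x u i l b" if "nearer x u i l a" for l
      using that \<open>nearer x u i a b\<close> by (auto simp: nearer_def)
    ultimately show "{l \<in> S. nearer x u i l a} \<subset> {l \<in> S. nearer x u i l b}"
      using that by blast
  qed
  have total: "nearer x u i a b \<or> nearer x u i b a" if "a \<noteq> b" for a b
    using that by (auto simp: nearer_def)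
  have inj: "inj_on r S"
    by (rule inj_onI) (metis total mono less_irrefl)
  have "r j < card S" if "j \<in> S" for j
    unfolding r_def using that
    by (intro psubset_card_mono[OF fin]) (auto simp: nearer_def)
  then have "r ` S \<subseteq> {..<card S}" by auto
  then have img: "r ` S = {..<card S}"
    by (intro card_subset_eq) (auto simp: card_image[OF inj])
  have "knn_set n x u k i = {j \<in> S. r j < k}"
    by (simp add: knn_set_def S_def r_def)
  moreover have "r ` {j \<in> S. r j < k} = {..<k}"
    using img assms(2) cS by (auto simp: set_eq_iff image_iff) (metis order_less_le_trans)
  moreover have "inj_on r {j \<in> S. r j < k}"
    using inj by (rule inj_on_subset) auto
  ultimately show ?thesis
    by (metis card_image card_lessThan)
qed

definition knn_est ::
  "nat \<Rightarrow> (nat \<Rightarrow> 'a::metric_space) \<Rightarrow> (nat \<Rightarrow> real) \<Rightarrow> (nat \<Rightarrow> real) \<Rightarrow> nat \<Rightarrow> nat \<Rightarrow> real" where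
  "knn_est n x u y k i = (1 / real k) * (\<Sum>j\<in>knn_set n x u k i. y j)"

definition response :: "('a \<Rightarrow> real) \<Rightarrow> (nat \<Rightarrow> 'a) \<Rightarrow> (nat \<Rightarrow> real) \<Rightarrow> nat \<Rightarrow> real" where
  "response m x e i = m (x i) + e i"

text \<open>
  The joint law of \<open>n\<close> i.i.d. copies of a random variable with law \<open>D\<close>, and the law of the
  tie-breaking variables.  Noise and tie-breaking are independent.
\<close>

definition noise :: "nat \<Rightarrow> real measure \<Rightarrow> (nat \<Rightarrow> real) measure" where
  "noise n D = (\<Pi>\<^sub>M i\<in>{1..n}. D)"

definition tie_break :: "nat \<Rightarrow> (nat \<Rightarrow> real) measure" where
  "tie_break n = (\<Pi>\<^sub>M i\<in>{1..n}. uniform_measure lborel {0..1})"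

definition sample :: "nat \<Rightarrow> real measure \<Rightarrow> ((nat \<Rightarrow> real) \<times> (nat \<Rightarrow> real)) measure" where
  "sample n D = noise n D \<Otimes>\<^sub>M tie_break n"

text \<open>The expectation in the mean squared error is over the noise only: \<open>u\<close> stays fixed.\<close>

definition MSE ::
  "nat \<Rightarrow> (nat \<Rightarrow> 'a::metric_space) \<Rightarrow> ('a \<Rightarrow> real) \<Rightarrow> real measure \<Rightarrow> (nat \<Rightarrow> real) \<Rightarrow> nat \<Rightarrow> real" where
  "MSE n x m D u k =
     (\<integral>e. (1 / real n) * (\<Sum>i=1..n. (m (x i) - knn_est n x u (response m x e) k i)\<^sup>2) \<partial>noise n D)"

definition loo_cv ::
  "nat \<Rightarrow> (nat \<Rightarrow> 'a::metric_space) \<Rightarrow> (nat \<Rightarrow> real) \<Rightarrow> (nat \<Rightarrow> real) \<Rightarrow> nat \<Rightarrow> real" where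
  "loo_cv n x u y k = (1 / real n) * (\<Sum>i=1..n. (y i - knn_est n x u y k i)\<^sup>2)"

end

theory Submission
  imports Defs
begin

text \<open>
  Write \<open>A\<close> for the \<open>n \<times> n\<close> matrix with entry \<open>1/k\<close> at \<open>(i, j)\<close> when \<open>j\<close> is one of the \<open>k\<close> nearest neighbors
  of \<open>i\<close>, and \<open>0\<close> otherwise.  With \<open>y = \<mu> + e\<close>, \<open>G = A\<^sup>T A\<close> and \<open>\<sigma>\<^sup>2 = E e\<^sub>i\<^sup>2\<close>, expanding
  \<open>n f(k) = |(I - A)(\<mu> + e)|\<^sup>2\<close> and \<open>n MSE(k) = |(I - A)\<mu>|\<^sup>2 + \<sigma>\<^sup>2 tr G\<close> gives

    \<open>n f(k) - n MSE(k) - |e|\<^sup>2 = w \<bullet> e + \<Sum>\<^sub>i G\<^sub>i\<^sub>i (e\<^sub>i\<^sup>2 - \<sigma>\<^sup>2) + \<Sum>\<^sub>i\<^sub>\<noteq>\<^sub>j (G - 2A)\<^sub>i\<^sub>j e\<^sub>i e\<^sub>j\<close>,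
    \<open>w = 2 (I - A)\<^sup>T (I - A) \<mu>\<close>,

  a sum of centered terms, because \<open>A\<close> has zero diagonal (leave-one-out).  The term \<open>|e|\<^sup>2\<close> is the same for
  every \<open>k\<close>, so it cancels when two values of \<open>f\<close> are compared; hence the excess error of the minimizer of
  \<open>f\<close> is at most twice the largest fluctuation over \<open>k\<close> (\<open>excess_risk_deviation\<close>), and a union bound over the
  \<open>n - 1\<close> values of \<open>k\<close> produces the factor \<open>n\<close>.

  The constants do not depend on \<open>n\<close>, \<open>k\<close> or the points because the operator norm of \<open>A\<close> is bounded in terms
  of \<open>d\<close> alone.  The rows of \<open>A\<close> sum to one; by Stone's cone argument (\<open>Stone_column_count\<close>) a point is among
  the \<open>k\<close> nearest neighbors of at most \<open>\<gamma> k\<close> points, so the columns sum to at most \<open>\<gamma>\<close>, and Schur's test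
  turns both into operator norm bounds for \<open>A\<close>, \<open>G - 2A\<close> and the map from \<open>\<mu>\<close> to \<open>w\<close>.  Ties do not hurt: only
  points that coincide with the given one escape the cones, and those are ordered on the line by the
  tie-breaking variables, which are almost surely distinct.

  Each of the three fluctuations is controlled through its exponential moments.  The linear part is
  sub-Gaussian with variance proxy of order \<open>|\<mu>|\<^sup>2\<close>; the diagonal part is a sum of independent
  sub-exponential variables; the off-diagonal part satisfies a Hanson-Wright inequality
  (\<open>nn_integral_exp_off_diagonal\<close>).  For the last one only the operator norm \<open>L\<close> of the coefficient
  matrix \<open>M\<close> enters, which makes a short proof possible: average over all splittings of the index set into two halves, integrate
  out one half, which leaves the exponential of \<open>c |M v|\<^sup>2 \<le> c L\<^sup>2 |v|\<^sup>2\<close>, a product of one-dimensional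
  integrals.
\<close>

section \<open>Stone's lemma: how often a point is a nearest neighbor\<close>

text \<open>
  The sets \<open>{z. sgn z \<in> ball c (1/2)}\<close> are cones with apex \<open>0\<close> in which any two directions form an angle below
  sixty degrees; a cone cover is a finite family of axes whose cones exhaust the space without the origin.
\<close>

definition cone_cover :: "'a::real_normed_vector set \<Rightarrow> bool" where
  "cone_cover S \<longleftrightarrow> finite S \<and> (\<forall>z. z \<noteq> 0 \<longrightarrow> (\<exists>c\<in>S. sgn z \<in> ball c (1/2)))"

lemma ex_cone_cover:
  obtains S :: "'a::euclidean_space set" where "cone_cover S"
proof -
  have "compact (sphere (0::'a) 1)" by simp
  moreover have "\<And>c. c \<in> sphere (0::'a) 1 \<Longrightarrow> open (ball c (1/2))" by simp
  moreover have "sphere (0::'a) 1 \<subseteq> (\<Union>c\<in>sphere 0 1. ball c (1/2))" by force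
  ultimately obtain S where S: "S \<subseteq> sphere (0::'a) 1" "finite S" "sphere 0 1 \<subseteq> (\<Union>c\<in>S. ball c (1/2))"
    by (rule compactE_image)
  have "\<exists>c\<in>S. sgn z \<in> ball c (1/2)" if "z \<noteq> 0" for z
  proof -
    have "sgn z \<in> sphere 0 1" using that by (simp add: norm_sgn)
    then show ?thesis using S(3) by blast
  qed
  then show ?thesis using S(2) that by (auto simp: cone_cover_def)
qed

text \<open>
  Two directions of the same cone are at distance less than one, so their inner product exceeds \<open>1/2\<close>: in a
  triangle, the side opposite to an angle below sixty degrees is shorter than the longer of the other two
  sides.  The strict inequality makes ties within a cone harmless.
\<close>

lemma norm_diff_less_in_cone:
  fixes a b :: "'a::real_inner"
  assumes "a \<noteq> 0" "b \<noteq> 0" "sgn a \<in> ball c (1/2)" "sgn b \<in> ball c (1/2)" "norm a \<le> norm b"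
  shows "norm (b - a) < norm b"
proof -
  define p q where "p = sgn a" and "q = sgn b"
  have a: "a = norm a *\<^sub>R p" and b: "b = norm b *\<^sub>R q"
    using assms by (auto simp: p_def q_def sgn_div_norm)
  have n: "inner p p = 1" "inner q q = 1" using assms by (auto simp: p_def q_def norm_sgn dot_square_norm)
  have "dist p q < 1" using assms(3,4) dist_triangle_half_r[of c p 1 q]
    by (simp add: p_def q_def)
  then have "(norm (p - q))\<^sup>2 < 1" by (simp add: dist_norm power_less_one_iff abs_square_less_1)
  then have pq: "inner p q > 1/2"
    using n by (simp add: power2_norm_eq_inner inner_diff inner_commute)
  have "(norm (b - a))\<^sup>2 = (norm b)\<^sup>2 + (norm a)\<^sup>2 - 2 * (norm a * norm b) * inner p q"
  proof -
    have "(norm (b - a))\<^sup>2 = inner (norm b *\<^sub>R q - norm a *\<^sub>R p) (norm b *\<^sub>R q - norm a *\<^sub>R p)"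
      using a b by (metis power2_norm_eq_inner)
    also have "\<dots> = (norm b)\<^sup>2 + (norm a)\<^sup>2 - 2 * (norm a * norm b) * inner p q"
      by (simp add: inner_diff inner_commute n power2_eq_square algebra_simps)
    finally show ?thesis .
  qed
  also have "\<dots> < (norm b)\<^sup>2 + (norm a)\<^sup>2 - norm a * norm b"
    using pq assms(1,2) mult_strict_left_mono[of "1/2" "inner p q" "2 * (norm a * norm b)"] by simp
  also have "\<dots> \<le> (norm b)\<^sup>2"
    using mult_left_mono[OF assms(5), of "norm a"] by (simp add: power2_eq_square)
  finally show ?thesis by (rule power_less_imp_less_base) simp
qed

text \<open>
  The element \<open>i\<close> of \<open>Q\<close> that maximizes \<open>f\<close> ranks every other element of \<open>Q\<close> before \<open>j\<close>; since \<open>j\<close> is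
  among its \<open>k\<close> nearest neighbors, fewer than \<open>k\<close> points can come before \<open>j\<close>.
\<close>

lemma card_le_if_extremal_nearer:
  fixes f :: "nat \<Rightarrow> real"
  assumes Q: "Q \<subseteq> {i \<in> {1..n}. j \<in> knn_set n x u k i}"
    and near: "\<And>i l. i \<in> Q \<Longrightarrow> l \<in> Q \<Longrightarrow> l \<noteq> i \<Longrightarrow> f l \<le> f i \<Longrightarrow> nearer x u i l j"
  shows "card Q \<le> k"
proof (cases "Q = {}")
  case False
  have fin: "finite Q" using Q finite_subset by fastforce
  obtain i where i: "i \<in> Q" "\<And>l. l \<in> Q \<Longrightarrow> f l \<le> f i"
    using Max_in[of "f ` Q"] Max_ge[of "f ` Q"] fin False
    by (metis (no_types, lifting) finite_imageI imageE image_eqI image_is_empty)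
  have "card (Q - {i}) \<le> card {l \<in> {1..n} - {i}. nearer x u i l j}"
    using Q i near by (intro card_mono) auto
  also have "\<dots> < k" using Q i(1) by (auto simp: knn_set_def)
  finally show ?thesis using fin i(1) by (simp add: card_Diff_singleton)
qed simp

text \<open>
  Put the apex of the cones at \<open>x j\<close>.  Within one cone, the point farthest from \<open>x j\<close> is closer to all the
  others than to \<open>x j\<close>, so \<open>j\<close> is a neighbor of at most \<open>k\<close> points of that cone.  The points equal to \<open>x j\<close>
  are ordered by the tie-breaking variables, and the two half lines to the left and to the right of \<open>u j\<close>
  play the role of two further cones.
\<close>

lemma Stone_column_count:
  fixes S :: "'a::euclidean_space set" and x :: "nat \<Rightarrow> 'a"
  assumes S: "cone_cover S"
    and u: "inj_on u {1..n}" and j: "j \<in> {1..n}"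
  shows "card {i \<in> {1..n}. j \<in> knn_set n x u k i} \<le> (card S + 2) * k"
proof -
  define T where "T = {i \<in> {1..n}. j \<in> knn_set n x u k i}"
  define Q where "Q c = {i \<in> T. x i \<noteq> x j \<and> sgn (x i - x j) \<in> ball c (1/2)}" for c
  define L where "L = {i \<in> T. x i = x j \<and> u i < u j}"
  define R where "R = {i \<in> T. x i = x j \<and> u i > u j}"
  have finS: "finite S" using S by (simp add: cone_cover_def)
  have finT: "finite T" by (simp add: T_def)
  have cQ: "card (Q c) \<le> k" for c
  proof (rule card_le_if_extremal_nearer[of _ n j x u k "\<lambda>i. norm (x i - x j)"])
    fix i l assume "i \<in> Q c" "l \<in> Q c" "norm (x l - x j) \<le> norm (x i - x j)"
    then have "norm ((x i - x j) - (x l - x j)) < norm (x i - x j)"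
      by (intro norm_diff_less_in_cone[of _ _ c]) (auto simp: Q_def)
    then show "nearer x u i l j" by (simp add: nearer_def dist_norm)
  qed (auto simp: Q_def T_def)
  have cL: "card L \<le> k"
    by (rule card_le_if_extremal_nearer[of _ n j x u k "\<lambda>i. - u i"]) (auto simp: L_def T_def nearer_def)
  have cR: "card R \<le> k"
    by (rule card_le_if_extremal_nearer[of _ n j x u k u]) (auto simp: R_def T_def nearer_def)
  have "T \<subseteq> (\<Union>c\<in>S. Q c) \<union> (L \<union> R)"
  proof
    fix i assume i: "i \<in> T"
    then have "i \<noteq> j" "i \<in> {1..n}" using knn_set_subset[of n x u k i] by (auto simp: T_def)
    then have "u i \<noteq> u j" using u j inj_onD by metis
    then consider "x i \<noteq> x j" | "x i = x j" "u i < u j" | "x i = x j" "u i > u j" by linarith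
    then show "i \<in> (\<Union>c\<in>S. Q c) \<union> (L \<union> R)"
    proof cases
      case 1
      then obtain c where "c \<in> S" "sgn (x i - x j) \<in> ball c (1/2)"
        using S unfolding cone_cover_def by (metis right_minus_eq)
      then show ?thesis using 1 i unfolding Q_def by blast
    qed (use i in \<open>simp_all add: L_def R_def\<close>)
  qed
  then have "card T \<le> card ((\<Union>c\<in>S. Q c) \<union> (L \<union> R))"
    using finT finS by (intro card_mono) (auto simp: Q_def L_def R_def)
  also have "\<dots> \<le> card (\<Union>c\<in>S. Q c) + (card L + card R)"
    by (meson add_left_mono card_Un_le order_trans)
  also have "card (\<Union>c\<in>S. Q c) \<le> (\<Sum>c\<in>S. card (Q c))" by (rule card_UN_le[OF finS])
  also have "\<dots> \<le> (\<Sum>c\<in>S. k)" by (intro sum_mono cQ)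
  finally show ?thesis using cL cR by (simp add: T_def algebra_simps)
qed

section \<open>Operator norms from row and column sums\<close>

text \<open>
  Cauchy-Schwarz after splitting each entry into two factors \<open>sqrt \<bar>M i j\<bar>\<close>: the first collects a row sum, and
  summing the second over the rows collects a column sum.
\<close>

lemma Schur_test:
  fixes M :: "'i \<Rightarrow> 'j \<Rightarrow> real"
  assumes row: "\<And>i. i \<in> I \<Longrightarrow> (\<Sum>j\<in>J. \<bar>M i j\<bar>) \<le> R"
    and col: "\<And>j. j \<in> J \<Longrightarrow> (\<Sum>i\<in>I. \<bar>M i j\<bar>) \<le> C" and "0 \<le> R"
  shows "(\<Sum>i\<in>I. (\<Sum>j\<in>J. M i j * v j)\<^sup>2) \<le> R * C * (\<Sum>j\<in>J. (v j)\<^sup>2)"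
proof -
  have "(\<Sum>j\<in>J. M i j * v j)\<^sup>2 \<le> R * (\<Sum>j\<in>J. \<bar>M i j\<bar> * (v j)\<^sup>2)" if "i \<in> I" for i
  proof -
    have "(\<Sum>j\<in>J. M i j * v j)\<^sup>2 = (\<Sum>j\<in>J. sqrt \<bar>M i j\<bar> * (sgn (M i j) * sqrt \<bar>M i j\<bar> * v j))\<^sup>2"
      by (intro arg_cong[where f = "\<lambda>z. z\<^sup>2"] sum.cong refl) (simp add: sgn_if)
    also have "\<dots> \<le> (\<Sum>j\<in>J. (sqrt \<bar>M i j\<bar>)\<^sup>2) * (\<Sum>j\<in>J. (sgn (M i j) * sqrt \<bar>M i j\<bar> * v j)\<^sup>2)"
      by (rule Cauchy_Schwarz_ineq_sum)
    also have "\<dots> = (\<Sum>j\<in>J. \<bar>M i j\<bar>) * (\<Sum>j\<in>J. \<bar>M i j\<bar> * (v j)\<^sup>2)"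
      by (intro arg_cong2[where f = "(*)"] sum.cong refl) (auto simp: power_mult_distrib sgn_if)
    also have "\<dots> \<le> R * (\<Sum>j\<in>J. \<bar>M i j\<bar> * (v j)\<^sup>2)"
      by (intro mult_right_mono row that sum_nonneg) simp
    finally show ?thesis .
  qed
  then have "(\<Sum>i\<in>I. (\<Sum>j\<in>J. M i j * v j)\<^sup>2) \<le> (\<Sum>i\<in>I. R * (\<Sum>j\<in>J. \<bar>M i j\<bar> * (v j)\<^sup>2))"
    by (rule sum_mono)
  also have "\<dots> = R * (\<Sum>j\<in>J. (\<Sum>i\<in>I. \<bar>M i j\<bar>) * (v j)\<^sup>2)"
    by (simp add: sum_distrib_left[symmetric] sum_distrib_right) (subst sum.swap, simp)
  also have "\<dots> \<le> R * (\<Sum>j\<in>J. C * (v j)\<^sup>2)"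
    using assms(3) by (intro mult_left_mono sum_mono mult_right_mono col) auto
  finally show ?thesis by (simp add: sum_distrib_left mult.assoc)
qed

section \<open>Exponential moments of sub-Gaussian noise\<close>

lemma exp_le_add_exp_square: "exp x \<le> x + exp (x\<^sup>2)" for x :: real
proof -
  consider "x \<ge> 1" | "0 \<le> x" "x \<le> 1" | "x \<le> 0" by linarith
  then show ?thesis
  proof cases
    case 1
    then have "x \<le> x\<^sup>2" by (simp add: power2_eq_square)
    then have "exp x \<le> exp (x\<^sup>2)" by simp
    then show ?thesis using 1 by linarith
  next
    case 2
    then have "exp x \<le> 1 + x + x\<^sup>2" by (rule exp_bound)
    then show ?thesis using exp_ge_add_one_self[of "x\<^sup>2"] by linarith
  next
    case 3
    define y where "y = - x"
    have y: "y \<ge> 0" using 3 by (simp add: y_def)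
    have p: "1 - y + y\<^sup>2 \<ge> 0" using y sum_power2_ge_zero[of "y - 1" 0] by (simp add: power2_eq_square algebra_simps)
    have "1 \<le> 1 + (y\<^sup>2 + y ^ 3 + y ^ 4) / 2" using y by simp
    also have "\<dots> = (1 - y + y\<^sup>2) * (1 + y + y\<^sup>2 / 2)"
      by (simp add: field_simps power2_eq_square power3_eq_cube power4_eq_xxxx)
    also have "\<dots> \<le> (1 - y + y\<^sup>2) * exp y"
      by (intro mult_left_mono exp_lower_Taylor_quadratic y p)
    finally have "exp x \<le> 1 + x + x\<^sup>2" by (simp add: y_def exp_minus field_simps)
    then show ?thesis using exp_ge_add_one_self[of "x\<^sup>2"] by linarith
  qed
qed

text \<open>
  In the power series of the left side every term of order at least two picks up the factor
  \<open>\<theta> ^ n \<le> \<theta>\<^sup>2\<close>.  After integration this bounds the moment generating function of a nonnegative variable with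
  one exponential moment, once it is centered, by the exponential of a quadratic function of \<open>\<theta>\<close>.
\<close>

lemma exp_scaled_le:
  fixes \<theta> z :: real
  assumes "\<bar>\<theta>\<bar> \<le> 1" "z \<ge> 0"
  shows "exp (\<theta> * z) \<le> 1 + \<theta> * z + \<theta>\<^sup>2 * (exp z - 1 - z)"
proof -
  have sm: "summable (\<lambda>n. inverse (fact (n + 2)) *\<^sub>R (w ^ (n + 2)))" for w :: real
    by (rule summable_ignore_initial_segment[OF summable_exp_generic])
  have "(\<Sum>n. inverse (fact (n + 2)) *\<^sub>R ((\<theta> * z) ^ (n + 2)))
      \<le> (\<Sum>n. \<theta>\<^sup>2 * (inverse (fact (n + 2)) *\<^sub>R (z ^ (n + 2))))"
  proof (rule suminf_le[OF _ sm summable_mult[OF sm]])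
    fix n
    have "\<theta> ^ n \<le> \<bar>\<theta>\<bar> ^ n" by (metis abs_ge_self power_abs)
    also have "\<dots> \<le> 1" using assms by (simp add: power_le_one)
    finally have "\<theta>\<^sup>2 * \<theta> ^ n \<le> \<theta>\<^sup>2 * 1" by (intro mult_left_mono) auto
    then have "\<theta> ^ (n + 2) \<le> \<theta>\<^sup>2" by (simp add: power2_eq_square mult_ac)
    then show "inverse (fact (n + 2)) *\<^sub>R ((\<theta> * z) ^ (n + 2))
        \<le> \<theta>\<^sup>2 * (inverse (fact (n + 2)) *\<^sub>R (z ^ (n + 2)))"
      using assms(2) mult_right_mono[of "\<theta> ^ (n + 2)" "\<theta>\<^sup>2" "inverse (fact (n + 2)) * z ^ (n + 2)"]
      by (simp add: power_mult_distrib mult_ac)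
  qed
  also have "\<dots> = \<theta>\<^sup>2 * (\<Sum>n. inverse (fact (n + 2)) *\<^sub>R (z ^ (n + 2)))"
    by (rule suminf_mult[OF sm])
  finally show ?thesis
    using exp_first_two_terms[of "\<theta> * z"] exp_first_two_terms[of z] by simp
qed

text \<open>
  The last condition says that the Orlicz norm of a \<open>D\<close>-distributed variable for \<open>exp (z\<^sup>2) - 1\<close> is at most
  \<open>sqrt K\<close>.
\<close>

locale sub_gaussian_law = prob_space D for D :: "real measure" +
  fixes K :: real
  assumes K_pos: "K > 0" and sets_D[measurable_cong]: "sets D = sets borel"
    and integrable_id: "integrable D (\<lambda>e. e)" and mean_zero: "(\<integral>e. e \<partial>D) = 0"
    and psi2: "(\<integral>\<^sup>+e. ennreal (exp (e\<^sup>2 / K)) \<partial>D) \<le> 2"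
begin

definition sigma2 :: real where "sigma2 = (\<integral>e. e\<^sup>2 \<partial>D)"

lemma integrable_exp_square: "integrable D (\<lambda>e. exp (e\<^sup>2 / K))"
  using psi2 by (intro integrableI_nonneg) (auto intro: order_le_less_trans)

lemma integral_exp_square_le: "(\<integral>e. exp (e\<^sup>2 / K) \<partial>D) \<le> 2"
  using psi2 nn_integral_eq_integral[OF integrable_exp_square]
  by (simp flip: ennreal_numeral)

lemma integrable_square: "integrable D (\<lambda>e. e\<^sup>2)"
proof (rule Bochner_Integration.integrable_bound)
  show "integrable D (\<lambda>e. K * exp (e\<^sup>2 / K))" using integrable_exp_square by simp
  have "e\<^sup>2 \<le> K * exp (e\<^sup>2 / K)" for e
    using exp_ge_add_one_self[of "e\<^sup>2 / K"] K_pos by (simp add: field_simps)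
  then show "AE e in D. norm (e\<^sup>2) \<le> norm (K * exp (e\<^sup>2 / K))" using K_pos by simp
qed simp

lemma sigma2_nonneg: "sigma2 \<ge> 0"
  unfolding sigma2_def by (rule integral_nonneg_AE) simp

lemma nn_integral_le_of_majorant:
  assumes "integrable D g" "\<And>e. 0 \<le> f e" "\<And>e. f e \<le> g e" "(\<integral>e. g e \<partial>D) \<le> c"
  shows "(\<integral>\<^sup>+e. ennreal (f e) \<partial>D) \<le> ennreal c"
proof -
  have "(\<integral>\<^sup>+e. ennreal (f e) \<partial>D) \<le> (\<integral>\<^sup>+e. ennreal (g e) \<partial>D)"
    using assms by (intro nn_integral_mono ennreal_leI) auto
  also have "\<dots> = ennreal (\<integral>e. g e \<partial>D)"
    using assms order_trans by (intro nn_integral_eq_integral) blast+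
  finally show ?thesis using assms(4) ennreal_leI order_trans by blast
qed

text \<open>
  Convexity of the exponential on the segment from \<open>0\<close> to \<open>e\<^sup>2 / K\<close>; integrated, this scales the moment
  condition down to smaller exponents.
\<close>

lemma exp_square_chord:
  assumes "0 \<le> s" "s * K \<le> 1"
  shows "exp (s * e\<^sup>2) \<le> (1 - s * K) + s * K * exp (e\<^sup>2 / K)"
  using convex_onD[OF exp_convex, of "s * K" 0 "e\<^sup>2 / K"] assms K_pos by simp

lemma nn_integral_exp_square:
  assumes "0 \<le> s" "s * K \<le> 1"
  shows "(\<integral>\<^sup>+e. ennreal (exp (s * e\<^sup>2)) \<partial>D) \<le> ennreal (exp (s * K))"
proof (rule nn_integral_le_of_majorant[OF _ _ exp_square_chord[OF assms]])
  have "(\<integral>e. (1 - s * K) + s * K * exp (e\<^sup>2 / K) \<partial>D) = 1 - s * K + s * K * (\<integral>e. exp (e\<^sup>2 / K) \<partial>D)"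
    using integrable_exp_square by (simp add: prob_space)
  also have "\<dots> \<le> 1 - s * K + s * K * 2"
    using assms K_pos integral_exp_square_le by (intro add_left_mono mult_left_mono) auto
  also have "\<dots> \<le> exp (s * K)" using exp_ge_add_one_self[of "s * K"] by (simp add: algebra_simps)
  finally show "(\<integral>e. (1 - s * K) + s * K * exp (e\<^sup>2 / K) \<partial>D) \<le> exp (s * K)" .
qed (use integrable_exp_square in simp_all)

lemma integral_exp_square_scaled:
  assumes "0 \<le> s" "s * K \<le> 1"
  shows "integrable D (\<lambda>e. exp (s * e\<^sup>2))" "(\<integral>e. exp (s * e\<^sup>2) \<partial>D) \<le> exp (s * K)"
proof -
  show int: "integrable D (\<lambda>e. exp (s * e\<^sup>2))"
    using nn_integral_exp_square[OF assms] by (intro integrableI_nonneg) (auto intro: order_le_less_trans)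
  show "(\<integral>e. exp (s * e\<^sup>2) \<partial>D) \<le> exp (s * K)"
    using nn_integral_exp_square[OF assms] nn_integral_eq_integral[OF int] by simp
qed

text \<open>
  For small \<open>r\<close>, the mean-zero condition removes the linear term in \<open>exp x \<le> x + exp (x\<^sup>2)\<close>.  For large
  \<open>r\<close>, the inequality \<open>2 r e \<le> r\<^sup>2 K + e\<^sup>2 / K\<close> suffices, because the constant factor it costs is absorbed by
  \<open>exp (r\<^sup>2 K / 2)\<close>.
\<close>

lemma nn_integral_exp_linear: "(\<integral>\<^sup>+e. ennreal (exp (r * e)) \<partial>D) \<le> ennreal (exp (K * r\<^sup>2))"
proof (cases "r\<^sup>2 * K \<le> 1")
  case True
  note I = integral_exp_square_scaled[OF _ True, simplified]
  show ?thesis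
  proof (rule nn_integral_le_of_majorant)
    show "exp (r * e) \<le> r * e + exp (r\<^sup>2 * e\<^sup>2)" for e
      using exp_le_add_exp_square[of "r * e"] by (simp add: power_mult_distrib)
    show "integrable D (\<lambda>e. r * e + exp (r\<^sup>2 * e\<^sup>2))" using I integrable_id by simp
    show "(\<integral>e. r * e + exp (r\<^sup>2 * e\<^sup>2) \<partial>D) \<le> exp (K * r\<^sup>2)"
      using I integrable_id mean_zero by (simp add: mult.commute)
  qed simp
next
  case False
  have half: "1 / (2 * K) * K \<le> 1" "0 \<le> 1 / (2 * K)" using K_pos by auto
  note I = integral_exp_square_scaled[OF half(2) half(1)]
  show ?thesis
  proof (rule nn_integral_le_of_majorant)
    show "exp (r * e) \<le> exp (r\<^sup>2 * K / 2) * exp (1 / (2 * K) * e\<^sup>2)" for e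
    proof -
      have "0 \<le> (r * K - e)\<^sup>2" by simp
      then have "2 * K * (r * e) \<le> 2 * K * (r\<^sup>2 * K / 2 + 1 / (2 * K) * e\<^sup>2)"
        using K_pos by (simp add: power2_eq_square algebra_simps)
      then have "r * e \<le> r\<^sup>2 * K / 2 + 1 / (2 * K) * e\<^sup>2"
        by (rule mult_left_le_imp_le) (use K_pos in simp)
      then show ?thesis by (simp flip: exp_add)
    qed
    show "integrable D (\<lambda>e. exp (r\<^sup>2 * K / 2) * exp (1 / (2 * K) * e\<^sup>2))" using I by simp
    have "(\<integral>e. exp (r\<^sup>2 * K / 2) * exp (1 / (2 * K) * e\<^sup>2) \<partial>D)
        = exp (r\<^sup>2 * K / 2) * (\<integral>e. exp (1 / (2 * K) * e\<^sup>2) \<partial>D)" by simp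
    also have "\<dots> \<le> exp (r\<^sup>2 * K / 2) * exp (1 / (2 * K) * K)" using I by (intro mult_left_mono) auto
    also have "\<dots> \<le> exp (K * r\<^sup>2)" using False K_pos by (simp flip: exp_add add: mult.commute)
    finally show "(\<integral>e. exp (r\<^sup>2 * K / 2) * exp (1 / (2 * K) * e\<^sup>2) \<partial>D) \<le> exp (K * r\<^sup>2)" .
  qed simp
qed

lemma nn_integral_exp_centered_square:
  assumes "\<bar>\<theta>\<bar> * K \<le> 1"
  shows "(\<integral>\<^sup>+e. ennreal (exp (\<theta> * (e\<^sup>2 - sigma2))) \<partial>D) \<le> ennreal (exp (K\<^sup>2 * \<theta>\<^sup>2))"
proof (rule nn_integral_le_of_majorant)
  let ?g = "\<lambda>e. exp (- \<theta> * sigma2) * (1 + \<theta> * e\<^sup>2 + (\<theta> * K)\<^sup>2 * (exp (e\<^sup>2 / K) - 1 - e\<^sup>2 / K))"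
  have th: "\<bar>\<theta> * K\<bar> \<le> 1" using assms K_pos by (simp add: abs_mult)
  show "exp (\<theta> * (e\<^sup>2 - sigma2)) \<le> ?g e" for e
  proof -
    have "exp (\<theta> * (e\<^sup>2 - sigma2)) = exp (- \<theta> * sigma2) * exp (\<theta> * K * (e\<^sup>2 / K))"
      using K_pos by (simp add: algebra_simps flip: exp_add)
    also have "\<dots> \<le> exp (- \<theta> * sigma2) * (1 + \<theta> * K * (e\<^sup>2 / K) + (\<theta> * K)\<^sup>2 * (exp (e\<^sup>2 / K) - 1 - e\<^sup>2 / K))"
      using K_pos by (intro mult_left_mono exp_scaled_le th) auto
    finally show ?thesis using K_pos by simp
  qed
  show "integrable D ?g" using integrable_square integrable_exp_square by simp
  have "(\<integral>e. ?g e \<partial>D) = exp (- \<theta> * sigma2) *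
      (1 + \<theta> * sigma2 + (\<theta> * K)\<^sup>2 * ((\<integral>e. exp (e\<^sup>2 / K) \<partial>D) - 1 - sigma2 / K))"
    using integrable_square integrable_exp_square by (simp add: sigma2_def prob_space)
  also have "\<dots> \<le> exp (- \<theta> * sigma2) * (1 + \<theta> * sigma2 + (\<theta> * K)\<^sup>2 * 1)"
    using integral_exp_square_le sigma2_nonneg K_pos
    by (intro mult_left_mono add_left_mono) (auto intro: order_trans[OF diff_mono[of _ 2 0]])
  also have "\<dots> \<le> exp (- \<theta> * sigma2) * exp (\<theta> * sigma2 + (\<theta> * K)\<^sup>2 * 1)"
    using exp_ge_add_one_self[of "\<theta> * sigma2 + (\<theta> * K)\<^sup>2 * 1"]
    by (intro mult_left_mono) (simp_all add: add.assoc)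
  also have "\<dots> = exp (K\<^sup>2 * \<theta>\<^sup>2)" by (simp add: power_mult_distrib mult.commute flip: exp_add)
  finally show "(\<integral>e. ?g e \<partial>D) \<le> exp (K\<^sup>2 * \<theta>\<^sup>2)" .
qed simp

abbreviation iid :: "'i set \<Rightarrow> ('i \<Rightarrow> real) measure" where
  "iid I \<equiv> Pi\<^sub>M I (\<lambda>_. D)"

lemma product_sigma_finite_D: "product_sigma_finite (\<lambda>_. D)"
  by (intro product_sigma_finite.intro sigma_finite_measure_axioms)

lemma prob_space_iid: "prob_space (iid I)"
  by (intro prob_space_PiM prob_space_axioms)

lemma measurable_iid_component:
  assumes "i \<in> I"
  shows "(\<lambda>e. e i) \<in> borel_measurable (iid I)"
  using measurable_component_singleton[OF assms, of "\<lambda>_. D"]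
  by (simp add: measurable_cong_sets[OF refl sets_D])

lemma nn_integral_exp_sum_iid:
  fixes g :: "'i \<Rightarrow> real \<Rightarrow> real"
  assumes "finite I" and [measurable]: "\<And>i. i \<in> I \<Longrightarrow> g i \<in> borel_measurable borel"
    and le: "\<And>i. i \<in> I \<Longrightarrow> (\<integral>\<^sup>+e. ennreal (exp (g i e)) \<partial>D) \<le> ennreal (exp (b i))"
  shows "(\<integral>\<^sup>+e. ennreal (exp (\<Sum>i\<in>I. g i (e i))) \<partial>iid I) \<le> ennreal (exp (\<Sum>i\<in>I. b i))"
proof -
  interpret product_sigma_finite "\<lambda>_::'i. D" by (rule product_sigma_finite_D)
  have "(\<integral>\<^sup>+e. ennreal (exp (\<Sum>i\<in>I. g i (e i))) \<partial>iid I)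
      = (\<integral>\<^sup>+e. (\<Prod>i\<in>I. ennreal (exp (g i (e i)))) \<partial>iid I)"
    using assms(1) by (simp add: exp_sum prod_ennreal)
  also have "\<dots> = (\<Prod>i\<in>I. \<integral>\<^sup>+e. ennreal (exp (g i e)) \<partial>D)"
    using assms(1) by (intro product_nn_integral_prod) auto
  also have "\<dots> \<le> (\<Prod>i\<in>I. ennreal (exp (b i)))" by (intro prod_mono_ennreal le)
  also have "\<dots> = ennreal (exp (\<Sum>i\<in>I. b i))" using assms(1) by (simp add: exp_sum prod_ennreal)
  finally show ?thesis .
qed

end

section \<open>Decoupling and tail bounds\<close>

text \<open>
  For \<open>i \<noteq> j\<close>, a uniformly random subset of \<open>I\<close> contains \<open>i\<close> and misses \<open>j\<close> with probability \<open>1/4\<close>.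
\<close>

lemma sum_over_splittings:
  fixes a :: "'i \<Rightarrow> 'i \<Rightarrow> real"
  assumes "finite I"
  shows "4 * (\<Sum>J\<in>Pow I. \<Sum>i\<in>J. \<Sum>j\<in>I-J. a i j) = 2 ^ card I * (\<Sum>i\<in>I. \<Sum>j\<in>I-{i}. a i j)"
proof -
  have cnt: "4 * card {J\<in>Pow I. i \<in> J \<and> j \<notin> J} = 2 ^ card I" if "i \<in> I" "j \<in> I - {i}" for i j
  proof -
    have "bij_betw (insert i) (Pow (I - {i, j})) {J\<in>Pow I. i \<in> J \<and> j \<notin> J}"
      using that by (intro bij_betwI[where g = "\<lambda>J. J - {i}"]) auto
    then have "card {J\<in>Pow I. i \<in> J \<and> j \<notin> J} = 2 ^ card (I - {i, j})"
      using assms by (simp add: card_Pow flip: bij_betw_same_card)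
    moreover have "card I = card (I - {i, j}) + 2"
    proof -
      have "card {i, j} = 2" "{i, j} \<subseteq> I" using that by auto
      then show ?thesis using card_Diff_subset[of "{i, j}" I] card_mono[OF assms, of "{i, j}"] by simp
    qed
    ultimately show ?thesis by (simp add: power_add)
  qed
  have "(\<Sum>i\<in>J. \<Sum>j\<in>I-J. a i j) = (\<Sum>i\<in>I. \<Sum>j\<in>I-{i}. if i \<in> J \<and> j \<notin> J then a i j else 0)"
    if "J \<in> Pow I" for J
  proof -
    have "(\<Sum>i\<in>J. \<Sum>j\<in>I-J. a i j) = (\<Sum>i\<in>I. if i \<in> J then \<Sum>j\<in>I-J. a i j else 0)"
      using that assms by (subst sum.inter_restrict[symmetric]) (auto intro: sum.cong simp: Int_absorb1)
    also have "\<dots> = (\<Sum>i\<in>I. \<Sum>j\<in>I-{i}. if i \<in> J \<and> j \<notin> J then a i j else 0)"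
    proof (rule sum.cong[OF refl])
      fix i
      have "(\<Sum>j\<in>I-J. a i j) = (\<Sum>j\<in>I-{i}. if j \<notin> J then a i j else 0)" if "i \<in> J"
        using assms that by (intro sum.mono_neutral_cong_left) auto
      then show "(if i \<in> J then \<Sum>j\<in>I-J. a i j else 0)
          = (\<Sum>j\<in>I-{i}. if i \<in> J \<and> j \<notin> J then a i j else 0)" by auto
    qed
    finally show ?thesis .
  qed
  then have "4 * (\<Sum>J\<in>Pow I. \<Sum>i\<in>J. \<Sum>j\<in>I-J. a i j)
      = 4 * (\<Sum>J\<in>Pow I. \<Sum>i\<in>I. \<Sum>j\<in>I-{i}. if i \<in> J \<and> j \<notin> J then a i j else 0)" by simp
  also have "\<dots> = 4 * (\<Sum>i\<in>I. \<Sum>j\<in>I-{i}. \<Sum>J\<in>Pow I. if i \<in> J \<and> j \<notin> J then a i j else 0)"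
    by (subst sum.swap) (intro arg_cong2[where f = "(*)"] refl sum.cong sum.swap)
  also have "\<dots> = 4 * (\<Sum>i\<in>I. \<Sum>j\<in>I-{i}. real (card {J\<in>Pow I. i \<in> J \<and> j \<notin> J}) * a i j)"
    using assms by (intro arg_cong2[where f = "(*)"] refl sum.cong) (simp add: sum.If_cases Int_def)
  also have "\<dots> = (\<Sum>i\<in>I. \<Sum>j\<in>I-{i}. real (4 * card {J\<in>Pow I. i \<in> J \<and> j \<notin> J}) * a i j)"
    by (simp add: sum_distrib_left mult.assoc)
  also have "\<dots> = (\<Sum>i\<in>I. \<Sum>j\<in>I-{i}. 2 ^ card I * a i j)"
    by (intro sum.cong refl) (simp only: cnt of_nat_power of_nat_numeral)
  finally show ?thesis by (simp add: sum_distrib_left)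
qed

lemma exp_off_diagonal_le_average:
  fixes a :: "'i \<Rightarrow> 'i \<Rightarrow> real"
  assumes "finite I"
  shows "exp (\<Sum>i\<in>I. \<Sum>j\<in>I-{i}. a i j)
    \<le> (\<Sum>J\<in>Pow I. (1 / 2 ^ card I) * exp (4 * (\<Sum>i\<in>J. \<Sum>j\<in>I-J. a i j)))"
proof -
  have "(\<Sum>i\<in>I. \<Sum>j\<in>I-{i}. a i j)
      = (\<Sum>J\<in>Pow I. (1 / 2 ^ card I) *\<^sub>R (4 * (\<Sum>i\<in>J. \<Sum>j\<in>I-J. a i j)))"
    using sum_over_splittings[OF assms, of a] by (simp flip: sum_distrib_left sum_divide_distrib)
  also have "exp \<dots> \<le> (\<Sum>J\<in>Pow I. (1 / 2 ^ card I) * exp (4 * (\<Sum>i\<in>J. \<Sum>j\<in>I-J. a i j)))"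
    using assms by (intro convex_on_sum[OF _ _ exp_convex]) (auto simp: card_Pow)
  finally show ?thesis .
qed

text \<open>
  Bernstein's tail: a quadratic bound on the logarithm of the moment generating function, valid only for
  \<open>\<bar>r\<bar> \<le> c\<close>, yields a Gaussian tail for small deviations and an exponential one for large deviations.
\<close>

lemma (in prob_space) two_sided_Chernoff:
  assumes [measurable]: "X \<in> borel_measurable M" and "b > 0" "c > 0" "s \<ge> 0"
    and mgf: "\<And>r. \<bar>r\<bar> \<le> c \<Longrightarrow> (\<integral>\<^sup>+\<omega>. ennreal (exp (r * X \<omega>)) \<partial>M) \<le> ennreal (exp (N * b * r\<^sup>2))"
    and "N \<ge> 0"
  shows "prob {\<omega> \<in> space M. N * s \<le> \<bar>X \<omega>\<bar>} \<le> 2 * exp (- N * min (s\<^sup>2 / (4 * b)) (c * s / 2))"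
proof -
  \<comment> \<open>The unconstrained minimizer of \<open>b r\<^sup>2 - r s\<close> is \<open>s / (2 b)\<close>; it is cut off at \<open>c\<close>.\<close>
  define r where "r = min (s / (2 * b)) c"
  have r: "0 \<le> r" "r \<le> c" "2 * b * r \<le> s" using assms by (auto simp: r_def min_def field_simps)
  have ex: "N * b * r\<^sup>2 - r * (N * s) \<le> - N * min (s\<^sup>2 / (4 * b)) (c * s / 2)"
  proof -
    have "min (s\<^sup>2 / (4 * b)) (c * s / 2) = r * s / 2"
    proof (cases "s \<le> 2 * b * c")
      case True
      then have "s * s \<le> (2 * b * c) * s" using \<open>s \<ge> 0\<close> by (rule mult_right_mono)
      then have "s\<^sup>2 / (4 * b) \<le> c * s / 2" "r = s / (2 * b)"
        using True assms by (auto simp: r_def min_def field_simps power2_eq_square)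
      then show ?thesis using assms by (simp add: min_def power2_eq_square)
    next
      case False
      then have "(2 * b * c) * s \<le> s * s" using \<open>s \<ge> 0\<close> by (intro mult_right_mono) auto
      then have "c * s / 2 \<le> s\<^sup>2 / (4 * b)" "r = c"
        using False assms by (auto simp: r_def min_def field_simps power2_eq_square)
      then show ?thesis by (simp add: min_def)
    qed
    moreover have "b * r\<^sup>2 - r * s \<le> - (r * s / 2)"
      using mult_left_mono[OF r(3) r(1)] by (simp add: power2_eq_square algebra_simps)
    from mult_left_mono[OF this \<open>N \<ge> 0\<close>] have "N * b * r\<^sup>2 - r * (N * s) \<le> - N * (r * s / 2)"
      by (simp add: algebra_simps)
    ultimately show ?thesis by (simp only: minus_mult_left[symmetric])
  qed
  have one: "prob {\<omega> \<in> space M. N * s \<le> \<tau> * X \<omega>} \<le> exp (- N * min (s\<^sup>2 / (4 * b)) (c * s / 2))"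
    if \<tau>: "\<bar>\<tau>\<bar> = 1" for \<tau> :: real
  proof -
    have "emeasure M {\<omega> \<in> space M. N * s \<le> \<tau> * X \<omega>}
        = (\<integral>\<^sup>+\<omega>. indicator {\<omega> \<in> space M. N * s \<le> \<tau> * X \<omega>} \<omega> \<partial>M)" by simp
    also have "\<dots> \<le> (\<integral>\<^sup>+\<omega>. ennreal (exp (- r * (N * s))) * ennreal (exp (r * \<tau> * X \<omega>)) \<partial>M)"
    proof (rule nn_integral_mono)
      fix \<omega>
      have "ennreal 1 \<le> ennreal (exp (- r * (N * s)) * exp (r * \<tau> * X \<omega>))" if "N * s \<le> \<tau> * X \<omega>"
        using mult_left_mono[OF that r(1)] by (intro ennreal_leI) (simp flip: exp_add add: mult.assoc)
      then show "indicator {\<omega> \<in> space M. N * s \<le> \<tau> * X \<omega>} \<omega>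
          \<le> ennreal (exp (- r * (N * s))) * ennreal (exp (r * \<tau> * X \<omega>))"
        by (auto simp: indicator_def simp flip: ennreal_mult)
    qed
    also have "\<dots> = ennreal (exp (- r * (N * s))) * (\<integral>\<^sup>+\<omega>. ennreal (exp (r * \<tau> * X \<omega>)) \<partial>M)"
      by (intro nn_integral_cmult) simp
    also have "\<dots> \<le> ennreal (exp (- r * (N * s))) * ennreal (exp (N * b * (r * \<tau>)\<^sup>2))"
      using r \<tau> by (intro mult_left_mono mgf) (auto simp: abs_mult)
    also have "\<dots> = ennreal (exp (N * b * r\<^sup>2 - r * (N * s)))"
    proof -
      have "\<tau>\<^sup>2 = 1" using \<tau> by (metis one_power2 power2_abs)
      then show ?thesis by (simp add: power_mult_distrib flip: ennreal_mult exp_add)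
    qed
    also have "\<dots> \<le> ennreal (exp (- N * min (s\<^sup>2 / (4 * b)) (c * s / 2)))"
      using ex by (intro ennreal_leI) simp
    finally show ?thesis by (simp add: emeasure_eq_measure)
  qed
  have "prob {\<omega> \<in> space M. N * s \<le> \<bar>X \<omega>\<bar>}
      \<le> prob ({\<omega> \<in> space M. N * s \<le> 1 * X \<omega>} \<union> {\<omega> \<in> space M. N * s \<le> (-1) * X \<omega>})"
    by (intro finite_measure_mono) auto
  also have "\<dots> \<le> prob {\<omega> \<in> space M. N * s \<le> 1 * X \<omega>} + prob {\<omega> \<in> space M. N * s \<le> (-1) * X \<omega>}"
    by (intro measure_Un_le) auto
  finally show ?thesis using one[of 1] one[of "-1"] by simp
qed

context sub_gaussian_law begin

lemma measurable_bilinear_iid: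
  fixes M :: "'i \<Rightarrow> 'i \<Rightarrow> real"
  assumes "A \<subseteq> I" "\<And>i. i \<in> A \<Longrightarrow> B i \<subseteq> I"
  shows "(\<lambda>e. \<Sum>i\<in>A. \<Sum>j\<in>B i. M i j * (e i * e j)) \<in> borel_measurable (iid I)"
  using assms
  by (intro borel_measurable_sum borel_measurable_times borel_measurable_const measurable_iid_component)
    (auto simp: subset_iff)

text \<open>
  Given the coordinates \<open>v\<close> outside \<open>J\<close>, the exponent is linear in the independent coordinates of \<open>J\<close>.
  Integrating these out leaves \<open>exp (K r\<^sup>2 |M v|\<^sup>2)\<close>, and the operator norm bound replaces the quadratic form
  by a multiple of \<open>|v|\<^sup>2\<close>, whose exponential factorizes over the coordinates.
\<close>

lemma nn_integral_exp_decoupled: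
  fixes M :: "'i \<Rightarrow> 'i \<Rightarrow> real"
  assumes I: "finite I" "J \<subseteq> I"
    and op: "\<And>v. (\<Sum>i\<in>I. (\<Sum>j\<in>I. M i j * v j)\<^sup>2) \<le> L\<^sup>2 * (\<Sum>j\<in>I. (v j)\<^sup>2)"
    and r: "K\<^sup>2 * L\<^sup>2 * r\<^sup>2 \<le> 1"
  shows "(\<integral>\<^sup>+e. ennreal (exp (r * (\<Sum>i\<in>J. \<Sum>j\<in>I-J. M i j * (e i * e j)))) \<partial>iid I)
     \<le> ennreal (exp (card I * (K\<^sup>2 * L\<^sup>2 * r\<^sup>2)))"
proof -
  interpret product_sigma_finite "\<lambda>_::'i. D" by (rule product_sigma_finite_D)
  let ?F = "\<lambda>e. ennreal (exp (r * (\<Sum>i\<in>J. \<Sum>j\<in>I-J. M i j * (e i * e j))))"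
  have fin: "finite J" "finite (I - J)" using I finite_subset by auto
  have un: "(I - J) \<union> J = I" using I by auto
  have "?F \<in> borel_measurable (iid I)"
    using measurable_bilinear_iid[of J I "\<lambda>_. I - J" M] I(2) by simp
  then have "(\<integral>\<^sup>+e. ?F e \<partial>iid I) = (\<integral>\<^sup>+v. (\<integral>\<^sup>+w. ?F (merge (I - J) J (v, w)) \<partial>iid J) \<partial>iid (I - J))"
    using product_nn_integral_fold[of "I - J" J ?F] fin un by auto
  also have "\<dots> \<le> (\<integral>\<^sup>+v. ennreal (exp (\<Sum>j\<in>I-J. (K * r\<^sup>2 * L\<^sup>2) * (v j)\<^sup>2)) \<partial>iid (I - J))"
  proof (rule nn_integral_mono)
    fix v
    define h where "h i = (\<Sum>j\<in>I-J. M i j * v j)" for i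
    have "?F (merge (I - J) J (v, w)) = ennreal (exp (\<Sum>i\<in>J. (r * h i) * w i))" for w
    proof -
      have "r * (\<Sum>i\<in>J. \<Sum>j\<in>I-J. M i j * (merge (I - J) J (v, w) i * merge (I - J) J (v, w) j))
          = r * (\<Sum>i\<in>J. \<Sum>j\<in>I-J. M i j * (w i * v j))"
        by (intro arg_cong2[where f = "(*)"] refl sum.cong) (auto simp: merge_def)
      also have "\<dots> = (\<Sum>i\<in>J. (r * h i) * w i)"
        by (simp add: h_def sum_distrib_left sum_distrib_right mult_ac)
      finally show ?thesis by simp
    qed
    then have "(\<integral>\<^sup>+w. ?F (merge (I - J) J (v, w)) \<partial>iid J) = (\<integral>\<^sup>+w. ennreal (exp (\<Sum>i\<in>J. (r * h i) * w i)) \<partial>iid J)"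
      by simp
    also have "\<dots> \<le> ennreal (exp (\<Sum>i\<in>J. K * (r * h i)\<^sup>2))"
      by (rule nn_integral_exp_sum_iid[OF fin(1) _ nn_integral_exp_linear]) simp
    also have "\<dots> \<le> ennreal (exp (\<Sum>j\<in>I-J. (K * r\<^sup>2 * L\<^sup>2) * (v j)\<^sup>2))"
    proof (intro ennreal_leI, simp only: exp_le_cancel_iff)
      \<comment> \<open>Extending \<open>v\<close> by zero lets the operator norm on all of \<open>I\<close> bound the block of \<open>M\<close>.\<close>
      define v' where "v' j = (if j \<in> J then 0 else v j)" for j
      have h: "h i = (\<Sum>j\<in>I. M i j * v' j)" for i
        unfolding h_def using I by (intro sum.mono_neutral_cong_left) (auto simp: v'_def)
      have "(\<Sum>i\<in>J. (h i)\<^sup>2) \<le> (\<Sum>i\<in>I. (h i)\<^sup>2)" using I by (intro sum_mono2) auto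
      also have "\<dots> \<le> L\<^sup>2 * (\<Sum>j\<in>I. (v' j)\<^sup>2)" unfolding h by (rule op)
      also have "(\<Sum>j\<in>I. (v' j)\<^sup>2) = (\<Sum>j\<in>I-J. (v j)\<^sup>2)"
        using I by (intro sum.mono_neutral_cong_right) (auto simp: v'_def)
      finally have "(K * r\<^sup>2) * (\<Sum>i\<in>J. (h i)\<^sup>2) \<le> (K * r\<^sup>2) * (L\<^sup>2 * (\<Sum>j\<in>I-J. (v j)\<^sup>2))"
        using K_pos by (intro mult_left_mono) auto
      then show "(\<Sum>i\<in>J. K * (r * h i)\<^sup>2) \<le> (\<Sum>j\<in>I-J. (K * r\<^sup>2 * L\<^sup>2) * (v j)\<^sup>2)"
        by (simp add: sum_distrib_left power_mult_distrib mult.assoc)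
    qed
    finally show "(\<integral>\<^sup>+w. ?F (merge (I - J) J (v, w)) \<partial>iid J)
      \<le> ennreal (exp (\<Sum>j\<in>I-J. (K * r\<^sup>2 * L\<^sup>2) * (v j)\<^sup>2))" .
  qed
  also have "\<dots> \<le> ennreal (exp (\<Sum>j\<in>I-J. (K * r\<^sup>2 * L\<^sup>2) * K))"
  proof (intro nn_integral_exp_sum_iid nn_integral_exp_square fin)
    show "0 \<le> K * r\<^sup>2 * L\<^sup>2" using K_pos by simp
    show "K * r\<^sup>2 * L\<^sup>2 * K \<le> 1" using r by (simp add: power2_eq_square mult_ac)
  qed simp
  also have "\<dots> \<le> ennreal (exp (card I * (K\<^sup>2 * L\<^sup>2 * r\<^sup>2)))"
  proof (intro ennreal_leI, simp only: exp_le_cancel_iff)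
    have "(\<Sum>j\<in>I-J. (K * r\<^sup>2 * L\<^sup>2) * K) = real (card (I - J)) * (K\<^sup>2 * L\<^sup>2 * r\<^sup>2)"
      by (simp add: power2_eq_square mult_ac)
    also have "\<dots> \<le> card I * (K\<^sup>2 * L\<^sup>2 * r\<^sup>2)"
      using card_mono[of I "I - J"] I(1) by (intro mult_right_mono) auto
    finally show "(\<Sum>j\<in>I-J. (K * r\<^sup>2 * L\<^sup>2) * K) \<le> card I * (K\<^sup>2 * L\<^sup>2 * r\<^sup>2)" .
  qed
  finally show ?thesis .
qed

text \<open>
  The Hanson-Wright bound in terms of the operator norm.  Jensen's inequality for the average over splittings
  costs the factor \<open>4\<close> in the exponent, hence the \<open>16\<close>.
\<close>

lemma nn_integral_exp_off_diagonal:
  fixes M :: "'i \<Rightarrow> 'i \<Rightarrow> real"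
  assumes I: "finite I"
    and op: "\<And>v. (\<Sum>i\<in>I. (\<Sum>j\<in>I. M i j * v j)\<^sup>2) \<le> L\<^sup>2 * (\<Sum>j\<in>I. (v j)\<^sup>2)"
    and r: "16 * K\<^sup>2 * L\<^sup>2 * r\<^sup>2 \<le> 1"
  shows "(\<integral>\<^sup>+e. ennreal (exp (r * (\<Sum>i\<in>I. \<Sum>j\<in>I-{i}. M i j * (e i * e j)))) \<partial>iid I)
     \<le> ennreal (exp (card I * (16 * K\<^sup>2 * L\<^sup>2) * r\<^sup>2))"
proof -
  let ?X = "\<lambda>J e. \<Sum>i\<in>J. \<Sum>j\<in>I-J. M i j * (e i * e j)"
  have "(\<integral>\<^sup>+e. ennreal (exp (r * (\<Sum>i\<in>I. \<Sum>j\<in>I-{i}. M i j * (e i * e j)))) \<partial>iid I)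
      \<le> (\<integral>\<^sup>+e. (\<Sum>J\<in>Pow I. ennreal (1 / 2 ^ card I) * ennreal (exp ((4 * r) * ?X J e))) \<partial>iid I)"
  proof (rule nn_integral_mono)
    fix e :: "'i \<Rightarrow> real"
    have "exp (r * (\<Sum>i\<in>I. \<Sum>j\<in>I-{i}. M i j * (e i * e j)))
        \<le> (\<Sum>J\<in>Pow I. (1 / 2 ^ card I) * exp ((4 * r) * ?X J e))"
      using exp_off_diagonal_le_average[OF I, of "\<lambda>i j. r * (M i j * (e i * e j))"]
      by (simp add: mult.assoc flip: sum_distrib_left)
    then show "ennreal (exp (r * (\<Sum>i\<in>I. \<Sum>j\<in>I-{i}. M i j * (e i * e j))))
        \<le> (\<Sum>J\<in>Pow I. ennreal (1 / 2 ^ card I) * ennreal (exp ((4 * r) * ?X J e)))"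
      by (simp add: ennreal_leI sum_ennreal flip: ennreal_mult)
  qed
  also have "\<dots> = (\<Sum>J\<in>Pow I. ennreal (1 / 2 ^ card I) * (\<integral>\<^sup>+e. ennreal (exp ((4 * r) * ?X J e)) \<partial>iid I))"
  proof -
    have "(\<lambda>e. ennreal (exp ((4 * r) * ?X J e))) \<in> borel_measurable (iid I)" if "J \<in> Pow I" for J
      using measurable_bilinear_iid[of J I "\<lambda>_. I - J" M] that by simp
    then show ?thesis
      by (subst nn_integral_sum) (auto intro!: sum.cong nn_integral_cmult)
  qed
  also have "\<dots> \<le> (\<Sum>J\<in>Pow I. ennreal (1 / 2 ^ card I) * ennreal (exp (card I * (K\<^sup>2 * L\<^sup>2 * (4 * r)\<^sup>2))))"
    using r by (intro sum_mono mult_left_mono nn_integral_exp_decoupled[OF I _ op]) (auto simp: power_mult_distrib)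
  also have "\<dots> = ennreal (\<Sum>J\<in>Pow I. 1 / 2 ^ card I * exp (card I * (K\<^sup>2 * L\<^sup>2 * (4 * r)\<^sup>2)))"
    by (simp add: sum_ennreal del: sum_constant flip: ennreal_mult)
  also have "\<dots> = ennreal (exp (card I * (16 * K\<^sup>2 * L\<^sup>2) * r\<^sup>2))"
    using I by (simp add: card_Pow power_mult_distrib mult_ac)
  finally show ?thesis .
qed

lemma tail_off_diagonal:
  fixes M :: "'i \<Rightarrow> 'i \<Rightarrow> real" and s :: real
  assumes I: "finite I" and "L > 0" "s \<ge> 0"
    and op: "\<And>v. (\<Sum>i\<in>I. (\<Sum>j\<in>I. M i j * v j)\<^sup>2) \<le> L\<^sup>2 * (\<Sum>j\<in>I. (v j)\<^sup>2)"
  shows "measure (iid I) {e \<in> space (iid I). card I * s \<le> \<bar>\<Sum>i\<in>I. \<Sum>j\<in>I-{i}. M i j * (e i * e j)\<bar>}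
    \<le> 2 * exp (- real (card I) * min (s\<^sup>2 / (64 * (K * L)\<^sup>2)) (s / (8 * (K * L))))"
proof -
  interpret iid: prob_space "iid I" by (rule prob_space_iid)
  have "measure (iid I) {e \<in> space (iid I). card I * s \<le> \<bar>\<Sum>i\<in>I. \<Sum>j\<in>I-{i}. M i j * (e i * e j)\<bar>}
    \<le> 2 * exp (- real (card I) * min (s\<^sup>2 / (4 * (16 * K\<^sup>2 * L\<^sup>2))) (1 / (4 * (K * L)) * s / 2))"
  proof (rule iid.two_sided_Chernoff)
    fix r :: real assume "\<bar>r\<bar> \<le> 1 / (4 * (K * L))"
    then have "\<bar>4 * (K * L) * r\<bar> \<le> 1" using K_pos \<open>L > 0\<close> by (simp add: abs_mult field_simps)
    then have "(4 * (K * L) * r)\<^sup>2 \<le> 1" by (simp only: abs_square_le_1)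
    then show "(\<integral>\<^sup>+e. ennreal (exp (r * (\<Sum>i\<in>I. \<Sum>j\<in>I-{i}. M i j * (e i * e j)))) \<partial>iid I)
        \<le> ennreal (exp (card I * (16 * K\<^sup>2 * L\<^sup>2) * r\<^sup>2))"
      by (intro nn_integral_exp_off_diagonal I op) (simp add: power_mult_distrib)
  qed (use K_pos assms in \<open>auto intro!: measurable_bilinear_iid\<close>)
  then show ?thesis by (simp add: power_mult_distrib mult.assoc)
qed

lemma tail_diagonal:
  fixes G :: "'i \<Rightarrow> real" and s :: real
  assumes I: "finite I" and "L > 0" "s \<ge> 0" and G: "\<And>i. i \<in> I \<Longrightarrow> \<bar>G i\<bar> \<le> L"
  shows "measure (iid I) {e \<in> space (iid I). card I * s \<le> \<bar>\<Sum>i\<in>I. G i * ((e i)\<^sup>2 - sigma2)\<bar>}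
    \<le> 2 * exp (- real (card I) * min (s\<^sup>2 / (4 * (K * L)\<^sup>2)) (s / (2 * (K * L))))"
proof -
  interpret iid: prob_space "iid I" by (rule prob_space_iid)
  have "measure (iid I) {e \<in> space (iid I). card I * s \<le> \<bar>\<Sum>i\<in>I. G i * ((e i)\<^sup>2 - sigma2)\<bar>}
    \<le> 2 * exp (- real (card I) * min (s\<^sup>2 / (4 * (K * L)\<^sup>2)) (1 / (K * L) * s / 2))"
  proof (rule iid.two_sided_Chernoff)
    fix r :: real assume r: "\<bar>r\<bar> \<le> 1 / (K * L)"
    have rG: "\<bar>r * G i\<bar> * K \<le> 1" if "i \<in> I" for i
    proof -
      have "\<bar>r\<bar> * \<bar>G i\<bar> \<le> 1 / (K * L) * L" using r G[OF that] K_pos \<open>L > 0\<close> by (intro mult_mono) auto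
      then show ?thesis using K_pos \<open>L > 0\<close> by (simp add: abs_mult field_simps)
    qed
    have "(\<integral>\<^sup>+e. ennreal (exp (r * (\<Sum>i\<in>I. G i * ((e i)\<^sup>2 - sigma2)))) \<partial>iid I)
       = (\<integral>\<^sup>+e. ennreal (exp (\<Sum>i\<in>I. (r * G i) * ((e i)\<^sup>2 - sigma2))) \<partial>iid I)"
      by (simp add: sum_distrib_left mult.assoc)
    also have "\<dots> \<le> ennreal (exp (\<Sum>i\<in>I. K\<^sup>2 * (r * G i)\<^sup>2))"
      by (rule nn_integral_exp_sum_iid[OF I _ nn_integral_exp_centered_square[OF rG]]) simp_all
    also have "\<dots> \<le> ennreal (exp (\<Sum>i\<in>I. K\<^sup>2 * (r\<^sup>2 * L\<^sup>2)))"
      using G by (intro ennreal_leI, simp only: exp_le_cancel_iff power_mult_distrib)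
        (intro sum_mono mult_left_mono, use \<open>L > 0\<close> in \<open>auto simp: abs_le_square_iff[symmetric]\<close>)
    also have "\<dots> = ennreal (exp (card I * (K * L)\<^sup>2 * r\<^sup>2))"
      by (simp add: power_mult_distrib mult_ac)
    finally show "(\<integral>\<^sup>+e. ennreal (exp (r * (\<Sum>i\<in>I. G i * ((e i)\<^sup>2 - sigma2)))) \<partial>iid I)
        \<le> ennreal (exp (card I * (K * L)\<^sup>2 * r\<^sup>2))" .
  qed (use K_pos assms in auto)
  moreover have "1 / (K * L) * s / 2 = s / (2 * (K * L))" by simp
  ultimately show ?thesis by (simp only:)
qed

lemma tail_linear:
  fixes w :: "'i \<Rightarrow> real" and s V :: real
  assumes I: "finite I" and V: "(\<Sum>i\<in>I. (w i)\<^sup>2) \<le> V" and "V > 0" "s \<ge> 0"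
  shows "measure (iid I) {e \<in> space (iid I). s \<le> \<bar>\<Sum>i\<in>I. w i * e i\<bar>} \<le> 2 * exp (- (s\<^sup>2 / (4 * K * V)))"
proof -
  interpret iid: prob_space "iid I" by (rule prob_space_iid)
  have "measure (iid I) {e \<in> space (iid I). 1 * s \<le> \<bar>\<Sum>i\<in>I. w i * e i\<bar>}
    \<le> 2 * exp (- 1 * min (s\<^sup>2 / (4 * (K * V))) ((s + 1) / (2 * K * V) * s / 2))"
  \<comment> \<open>The moment bound holds for all \<open>r\<close>, so the cut-off only has to be large enough, namely at least
    \<open>s / (2 K V)\<close>, for the quadratic part to be the minimum; \<open>s + 1\<close> keeps it positive.\<close>
  proof (rule iid.two_sided_Chernoff)
    fix r :: real
    have "(\<integral>\<^sup>+e. ennreal (exp (r * (\<Sum>i\<in>I. w i * e i))) \<partial>iid I)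
       = (\<integral>\<^sup>+e. ennreal (exp (\<Sum>i\<in>I. (r * w i) * e i)) \<partial>iid I)"
      by (simp add: sum_distrib_left mult.assoc)
    also have "\<dots> \<le> ennreal (exp (\<Sum>i\<in>I. K * (r * w i)\<^sup>2))"
      by (rule nn_integral_exp_sum_iid[OF I _ nn_integral_exp_linear]) simp
    also have "(\<Sum>i\<in>I. K * (r * w i)\<^sup>2) = K * r\<^sup>2 * (\<Sum>i\<in>I. (w i)\<^sup>2)"
      by (simp add: sum_distrib_left power_mult_distrib mult.assoc)
    also have "ennreal (exp \<dots>) \<le> ennreal (exp (K * r\<^sup>2 * V))"
      using V K_pos by (intro ennreal_leI) (auto intro!: mult_left_mono)
    finally show "(\<integral>\<^sup>+e. ennreal (exp (r * (\<Sum>i\<in>I. w i * e i))) \<partial>iid I) \<le> ennreal (exp (1 * (K * V) * r\<^sup>2))"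
      by (simp add: mult_ac)
  qed (use K_pos assms in \<open>auto intro!: borel_measurable_sum\<close>)
  also have "min (s\<^sup>2 / (4 * (K * V))) ((s + 1) / (2 * K * V) * s / 2) = s\<^sup>2 / (4 * K * V)"
    using K_pos assms by (auto simp: min_def field_simps power2_eq_square)
  finally show ?thesis by simp
qed

end

section \<open>Linear smoothers: fluctuation of the residual sum of squares\<close>

definition smooth :: "'i set \<Rightarrow> ('i \<Rightarrow> 'i \<Rightarrow> real) \<Rightarrow> ('i \<Rightarrow> real) \<Rightarrow> 'i \<Rightarrow> real" where
  "smooth I a v i = (\<Sum>j\<in>I. a i j * v j)"

definition residual_ss :: "'i set \<Rightarrow> ('i \<Rightarrow> 'i \<Rightarrow> real) \<Rightarrow> ('i \<Rightarrow> real) \<Rightarrow> real" where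
  "residual_ss I a v = (\<Sum>i\<in>I. (v i - smooth I a v i)\<^sup>2)"

lemma square_sum_swap:
  fixes a :: "'i \<Rightarrow> 'j \<Rightarrow> real"
  shows "(\<Sum>i\<in>I. (\<Sum>j\<in>J. a i j * v j)\<^sup>2) = (\<Sum>j\<in>J. \<Sum>k\<in>J. (\<Sum>i\<in>I. a i j * a i k) * (v j * v k))"
proof -
  have "(\<Sum>i\<in>I. (\<Sum>j\<in>J. a i j * v j)\<^sup>2) = (\<Sum>i\<in>I. \<Sum>j\<in>J. \<Sum>k\<in>J. a i j * a i k * (v j * v k))"
    by (simp add: power2_eq_square sum_product mult_ac)
  also have "\<dots> = (\<Sum>j\<in>J. \<Sum>k\<in>J. \<Sum>i\<in>I. a i j * a i k * (v j * v k))"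
    by (subst sum.swap) (intro sum.cong refl sum.swap)
  finally show ?thesis by (simp add: sum_distrib_right)
qed

text \<open>
  The properties of the nearest-neighbor weights that matter: they average over points other than the point
  itself, and no point is used too often.
\<close>

locale averaging_matrix =
  fixes I :: "'i set" and a :: "'i \<Rightarrow> 'i \<Rightarrow> real" and \<gamma> :: real
  assumes finite_I: "finite I" and nonempty_I: "I \<noteq> {}"
    and nonneg: "0 \<le> a i j"
    and diag: "a i i = 0"
    and row_sum: "i \<in> I \<Longrightarrow> (\<Sum>j\<in>I. a i j) = 1"
    and col_sum: "j \<in> I \<Longrightarrow> (\<Sum>i\<in>I. a i j) \<le> \<gamma>"
    and gamma_ge_1: "1 \<le> \<gamma>"
begin

text \<open>
  In matrix notation, \<open>gram\<close> is \<open>A\<^sup>T A\<close>, \<open>form\<close> is \<open>A\<^sup>T A - 2 A\<close>, and \<open>lin v\<close> is \<open>2 (I - A)\<^sup>T (I - A) v\<close>.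
\<close>

definition gram :: "'i \<Rightarrow> 'i \<Rightarrow> real" where "gram i j = (\<Sum>l\<in>I. a l i * a l j)"
definition form :: "'i \<Rightarrow> 'i \<Rightarrow> real" where "form i j = gram i j - 2 * a i j"
definition lin :: "('i \<Rightarrow> real) \<Rightarrow> 'i \<Rightarrow> real" where
  "lin v j = 2 * ((v j - smooth I a v j) - (\<Sum>i\<in>I. a i j * (v i - smooth I a v i)))"

lemma gram_row_sum: assumes "i \<in> I" shows "(\<Sum>j\<in>I. gram i j) \<le> \<gamma>"
proof -
  have "(\<Sum>j\<in>I. gram i j) = (\<Sum>l\<in>I. a l i * (\<Sum>j\<in>I. a l j))"
    unfolding gram_def by (subst sum.swap) (simp add: sum_distrib_left)
  also have "\<dots> = (\<Sum>l\<in>I. a l i)" by (intro sum.cong refl) (simp add: row_sum)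
  finally show ?thesis using col_sum[OF assms] by simp
qed

lemma gram_nonneg: "0 \<le> gram i j"
  unfolding gram_def by (intro sum_nonneg mult_nonneg_nonneg nonneg)

lemma gram_sym: "gram i j = gram j i"
  by (simp add: gram_def mult.commute)

lemma gram_diag_bounds: assumes "i \<in> I" shows "\<bar>gram i i\<bar> \<le> \<gamma>"
  using gram_row_sum[OF assms] member_le_sum[OF assms, of "gram i"] gram_nonneg finite_I by force

lemma form_abs_le: "\<bar>form i j\<bar> \<le> gram i j + 2 * a i j"
  using gram_nonneg[of i j] nonneg[of i j] by (simp add: form_def)

lemma form_bound: "(\<Sum>i\<in>I. (\<Sum>j\<in>I. form i j * v j)\<^sup>2) \<le> (3 * \<gamma>)\<^sup>2 * (\<Sum>j\<in>I. (v j)\<^sup>2)"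
proof -
  have "(\<Sum>j\<in>I. \<bar>form i j\<bar>) \<le> 3 * \<gamma>" if "i \<in> I" for i
  proof -
    have "(\<Sum>j\<in>I. \<bar>form i j\<bar>) \<le> (\<Sum>j\<in>I. gram i j) + 2 * (\<Sum>j\<in>I. a i j)"
      using sum_mono[OF form_abs_le] by (simp add: sum.distrib sum_distrib_left)
    then show ?thesis using gram_row_sum[OF that] row_sum[OF that] gamma_ge_1 by simp
  qed
  moreover have "(\<Sum>i\<in>I. \<bar>form i j\<bar>) \<le> 3 * \<gamma>" if "j \<in> I" for j
  proof -
    have "(\<Sum>i\<in>I. \<bar>form i j\<bar>) \<le> (\<Sum>i\<in>I. gram j i + 2 * a i j)"
      by (intro sum_mono) (simp add: form_abs_le gram_sym[of j])
    also have "\<dots> = (\<Sum>i\<in>I. gram j i) + 2 * (\<Sum>i\<in>I. a i j)"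
      by (simp add: sum.distrib sum_distrib_left)
    finally have "(\<Sum>i\<in>I. \<bar>form i j\<bar>) \<le> (\<Sum>i\<in>I. gram j i) + 2 * (\<Sum>i\<in>I. a i j)" .
    then show ?thesis using gram_row_sum[OF that] col_sum[OF that] by simp
  qed
  ultimately show ?thesis
    using Schur_test[where M = form and I = I and J = I and R = "3 * \<gamma>" and C = "3 * \<gamma>" and v = v] gamma_ge_1 by (simp add: power2_eq_square)
qed

lemma lin_bound: "(\<Sum>j\<in>I. (lin v j)\<^sup>2) \<le> 16 * (1 + \<gamma>)\<^sup>2 * (\<Sum>i\<in>I. (v i)\<^sup>2)"
proof -
  define r where "r i = v i - smooth I a v i" for i
  have diff: "(p - q)\<^sup>2 \<le> 2 * p\<^sup>2 + 2 * q\<^sup>2" for p q :: real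
    using zero_le_power2[of "p + q"] by (simp add: power2_eq_square algebra_simps)
  have rows: "(\<Sum>j\<in>I. \<bar>a i j\<bar>) \<le> 1" "(\<Sum>l\<in>I. \<bar>a l i\<bar>) \<le> \<gamma>" if "i \<in> I" for i
    using row_sum[OF that] col_sum[OF that] nonneg by simp_all
  have "(\<Sum>i\<in>I. (r i)\<^sup>2) \<le> (\<Sum>i\<in>I. 2 * (v i)\<^sup>2 + 2 * (smooth I a v i)\<^sup>2)"
    unfolding r_def by (intro sum_mono diff)
  also have "\<dots> = 2 * (\<Sum>i\<in>I. (v i)\<^sup>2) + 2 * (\<Sum>i\<in>I. (smooth I a v i)\<^sup>2)"
    by (simp add: sum.distrib sum_distrib_left)
  also have "\<dots> \<le> 2 * (\<Sum>i\<in>I. (v i)\<^sup>2) + 2 * (1 * \<gamma> * (\<Sum>i\<in>I. (v i)\<^sup>2))"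
    unfolding smooth_def by (intro add_left_mono mult_left_mono Schur_test rows) auto
  finally have r: "(\<Sum>i\<in>I. (r i)\<^sup>2) \<le> 2 * (1 + \<gamma>) * (\<Sum>i\<in>I. (v i)\<^sup>2)" by (simp add: algebra_simps)
  have "(\<Sum>j\<in>I. (lin v j)\<^sup>2) = 4 * (\<Sum>j\<in>I. (r j - (\<Sum>i\<in>I. a i j * r i))\<^sup>2)"
    by (simp only: lin_def r_def power_mult_distrib sum_distrib_left) simp
  also have "\<dots> \<le> 4 * (\<Sum>j\<in>I. 2 * (r j)\<^sup>2 + 2 * (\<Sum>i\<in>I. a i j * r i)\<^sup>2)"
    by (intro mult_left_mono sum_mono diff) auto
  also have "\<dots> = 8 * (\<Sum>i\<in>I. (r i)\<^sup>2) + 8 * (\<Sum>j\<in>I. (\<Sum>i\<in>I. a i j * r i)\<^sup>2)"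
    by (simp add: sum.distrib sum_distrib_left)
  also have "\<dots> \<le> 8 * (\<Sum>i\<in>I. (r i)\<^sup>2) + 8 * (\<gamma> * 1 * (\<Sum>i\<in>I. (r i)\<^sup>2))"
    using gamma_ge_1 by (intro add_left_mono mult_left_mono Schur_test rows) auto
  also have "\<dots> = 8 * (1 + \<gamma>) * (\<Sum>i\<in>I. (r i)\<^sup>2)" by (simp add: algebra_simps)
  also have "\<dots> \<le> 8 * (1 + \<gamma>) * (2 * (1 + \<gamma>) * (\<Sum>i\<in>I. (v i)\<^sup>2))"
    using r gamma_ge_1 by (intro mult_left_mono) auto
  also have "\<dots> = 16 * (1 + \<gamma>)\<^sup>2 * (\<Sum>i\<in>I. (v i)\<^sup>2)"
    by (simp add: power2_eq_square algebra_simps)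
  finally show ?thesis .
qed

text \<open>
  Since \<open>a\<close> has zero diagonal, the cross term \<open>- 2 e \<bullet> A e\<close> contributes only off the diagonal of the quadratic
  form; this is where leaving one out makes the residual sum of squares, up to the noise energy, unbiased for the
  risk.
\<close>

lemma residual_ss_add:
  "residual_ss I a (\<lambda>i. v i + e i) = residual_ss I a v + (\<Sum>i\<in>I. (e i)\<^sup>2) + (\<Sum>i\<in>I. lin v i * e i)
     + (\<Sum>i\<in>I. gram i i * (e i)\<^sup>2) + (\<Sum>i\<in>I. \<Sum>j\<in>I-{i}. form i j * (e i * e j))"
proof -
  define r where "r i = v i - smooth I a v i" for i
  have "residual_ss I a (\<lambda>i. v i + e i) = (\<Sum>i\<in>I. (r i + (e i - smooth I a e i))\<^sup>2)"
    by (simp add: residual_ss_def smooth_def r_def sum.distrib algebra_simps)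
  also have "\<dots> = (\<Sum>i\<in>I. (r i)\<^sup>2 + (e i)\<^sup>2 + 2 * (r i * (e i - smooth I a e i)) + (smooth I a e i)\<^sup>2 - 2 * (e i * smooth I a e i))"
    by (intro sum.cong refl) (simp add: power2_eq_square algebra_simps)
  also have "\<dots> = residual_ss I a v + (\<Sum>i\<in>I. (e i)\<^sup>2) + 2 * (\<Sum>i\<in>I. r i * (e i - smooth I a e i))
      + ((\<Sum>i\<in>I. (smooth I a e i)\<^sup>2) - 2 * (\<Sum>i\<in>I. e i * smooth I a e i))"
    by (simp add: residual_ss_def r_def sum.distrib sum_subtractf sum_distrib_left)
  also have "2 * (\<Sum>i\<in>I. r i * (e i - smooth I a e i)) = (\<Sum>i\<in>I. lin v i * e i)"
  proof -
    have "(\<Sum>i\<in>I. r i * smooth I a e i) = (\<Sum>i\<in>I. \<Sum>j\<in>I. r i * (a i j * e j))"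
      by (simp add: smooth_def sum_distrib_left)
    also have "\<dots> = (\<Sum>j\<in>I. (\<Sum>i\<in>I. a i j * r i) * e j)"
      by (subst sum.swap) (simp add: sum_distrib_left sum_distrib_right mult_ac)
    finally show ?thesis
      by (simp add: lin_def right_diff_distrib left_diff_distrib sum_subtractf mult.assoc
          flip: sum_distrib_left r_def)
  qed
  also have "(\<Sum>i\<in>I. (smooth I a e i)\<^sup>2) - 2 * (\<Sum>i\<in>I. e i * smooth I a e i) = (\<Sum>i\<in>I. \<Sum>j\<in>I. form i j * (e i * e j))"
    unfolding smooth_def square_sum_swap
    by (simp add: form_def gram_def sum_distrib_left left_diff_distrib right_diff_distrib mult_ac
        flip: sum_subtractf)
  also have "\<dots> = (\<Sum>i\<in>I. gram i i * (e i)\<^sup>2 + (\<Sum>j\<in>I-{i}. form i j * (e i * e j)))"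
    using finite_I by (intro sum.cong refl) (simp add: sum.remove form_def diag power2_eq_square)
  finally show ?thesis by (simp add: sum.distrib)
qed

end

context sub_gaussian_law begin

text \<open>
  The expected squared error of the smoother at noise level \<open>sigma2\<close>: squared bias plus variance.
\<close>

definition risk :: "'i set \<Rightarrow> ('i \<Rightarrow> 'i \<Rightarrow> real) \<Rightarrow> ('i \<Rightarrow> real) \<Rightarrow> real" where
  "risk I a v = residual_ss I a v + sigma2 * (\<Sum>i\<in>I. \<Sum>j\<in>I. (a i j)\<^sup>2)"

lemma iid_moments:
  fixes I :: "'i set"
  assumes I: "finite I" and i: "i \<in> I" and j: "j \<in> I"
  shows "integrable (iid I) (\<lambda>e. e i)" "(\<integral>e. e i \<partial>iid I) = 0"
    and "integrable (iid I) (\<lambda>e. e i * e j)" "(\<integral>e. e i * e j \<partial>iid I) = (if i = j then sigma2 else 0)"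
proof -
  interpret product_sigma_finite "\<lambda>_::'i. D" by (rule product_sigma_finite_D)
  \<comment> \<open>Writing \<open>e i * e j\<close> as a product over all coordinates treats \<open>i = j\<close> and \<open>i \<noteq> j\<close> alike.\<close>
  define f where "f l e = (if l = i then e else 1)" for l and e :: real
  define g where "g l e = f l e * (if l = j then e else 1)" for l and e :: real
  have f: "integrable D (\<lambda>e. f l e)" "(\<integral>e. f l e \<partial>D) = (if l = i then 0 else 1)" for l
    using integrable_id mean_zero unfolding f_def by (cases "l = i"; simp add: prob_space)+
  have g: "integrable D (\<lambda>e. g l e)" for l
    using integrable_id integrable_square unfolding g_def f_def
    by (cases "l = i"; cases "l = j"; simp flip: power2_eq_square)
  have pf: "(\<Prod>l\<in>I. f l (e l)) = e i" for e
    using I i by (simp add: f_def prod.delta)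
  have pg: "(\<Prod>l\<in>I. g l (e l)) = e i * e j" for e
    using I i j pf by (simp add: g_def prod.distrib prod.delta)
  show "integrable (iid I) (\<lambda>e. e i)" using product_integrable_prod[OF I, of f] f by (simp add: pf)
  show "(\<integral>e. e i \<partial>iid I) = 0"
    using product_integral_prod[OF I, of f] f i I by (auto simp: pf)
  show "integrable (iid I) (\<lambda>e. e i * e j)" using product_integrable_prod[OF I, of g] g by (simp add: pg)
  have "(\<integral>e. e i * e j \<partial>iid I) = (\<Prod>l\<in>I. \<integral>e. g l e \<partial>D)"
    using product_integral_prod[OF I, of g] g by (simp add: pg)
  also have "\<dots> = (if i = j then sigma2 else 0)"
  proof (cases "i = j")
    case True
    then have "(\<integral>e. g l e \<partial>D) = (if l = i then sigma2 else 1)" for l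
      by (auto simp: g_def f_def sigma2_def prob_space simp flip: power2_eq_square)
    then show ?thesis using True I i by (simp add: prod.delta)
  next
    case False
    then have "(\<integral>e. g i e \<partial>D) = 0" using mean_zero by (simp add: g_def f_def)
    then show ?thesis using False I i by auto
  qed
  finally show "(\<integral>e. e i * e j \<partial>iid I) = (if i = j then sigma2 else 0)" .
qed

lemma expected_loss_eq_risk:
  assumes I: "finite I"
  shows "(\<integral>e. (\<Sum>i\<in>I. (v i - smooth I a (\<lambda>j. v j + e j) i)\<^sup>2) \<partial>iid I) = risk I a v"
proof -
  note m = iid_moments[OF I]
  interpret iid: prob_space "iid I" by (rule prob_space_iid)
  define r where "r i = v i - smooth I a v i" for i
  have "(v i - smooth I a (\<lambda>j. v j + e j) i)\<^sup>2
     = (r i)\<^sup>2 - (\<Sum>j\<in>I. (2 * r i * a i j) * e j) + (\<Sum>j\<in>I. \<Sum>k\<in>I. (a i j * a i k) * (e j * e k))" for i e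
  proof -
    have "v i - smooth I a (\<lambda>j. v j + e j) i = r i - smooth I a e i"
      by (simp add: smooth_def r_def sum.distrib algebra_simps)
    moreover have "(smooth I a e i)\<^sup>2 = (\<Sum>j\<in>I. \<Sum>k\<in>I. (a i j * a i k) * (e j * e k))"
      by (simp add: smooth_def power2_eq_square sum_product mult_ac)
    moreover have "2 * r i * smooth I a e i = (\<Sum>j\<in>I. (2 * r i * a i j) * e j)"
      by (simp add: smooth_def sum_distrib_left mult.assoc)
    ultimately show ?thesis by (simp add: power2_diff)
  qed
  then have "(\<integral>e. (\<Sum>i\<in>I. (v i - smooth I a (\<lambda>j. v j + e j) i)\<^sup>2) \<partial>iid I)
     = (\<integral>e. (\<Sum>i\<in>I. (r i)\<^sup>2 - (\<Sum>j\<in>I. (2 * r i * a i j) * e j) + (\<Sum>j\<in>I. \<Sum>k\<in>I. (a i j * a i k) * (e j * e k))) \<partial>iid I)"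
    by simp
  also have "\<dots> = (\<Sum>i\<in>I. (r i)\<^sup>2 + (\<Sum>j\<in>I. \<Sum>k\<in>I. (a i j * a i k) * (if j = k then sigma2 else 0)))"
    by (simp add: m Bochner_Integration.integrable_sum iid.prob_space)
  also have "\<dots> = (\<Sum>i\<in>I. (r i)\<^sup>2 + sigma2 * (\<Sum>j\<in>I. (a i j)\<^sup>2))"
    using I by (intro sum.cong refl)
      (simp add: if_distrib[of "(*) _"] sum_distrib_left power2_eq_square mult_ac cong: if_cong)
  finally show ?thesis by (simp add: risk_def residual_ss_def r_def sum.distrib sum_distrib_left)
qed

text \<open>
  A deviation of \<open>N t / 2\<close> forces one of the linear, diagonal and off-diagonal parts to exceed \<open>N t / 6\<close>.
  The coefficient matrix of the quadratic part has operator norm at most \<open>3 \<gamma>\<close>; the larger, off-diagonal tail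
  gives \<open>20736 = 64 (3 \<sqdot> 6)\<^sup>2\<close> and \<open>144 = 8 \<sqdot> 3 \<sqdot> 6\<close>, and it also covers the diagonal part.  The linear part has
  a coefficient vector of squared norm at most \<open>16 (1 + \<gamma>)\<^sup>2 |v|\<^sup>2\<close>, whence \<open>2304 = 4 \<sqdot> 16 \<sqdot> 6\<^sup>2\<close>; it vanishes identically if \<open>v\<close> does.
\<close>

lemma residual_ss_concentration:
  fixes t :: real
  assumes "averaging_matrix I a \<gamma>" and t: "t \<ge> 0"
  defines "N \<equiv> real (card I)"
  shows "measure (iid I) {e \<in> space (iid I).
      N * t / 2 \<le> \<bar>residual_ss I a (\<lambda>i. v i + e i) - (\<Sum>i\<in>I. (e i)\<^sup>2) - risk I a v\<bar>}
    \<le> 4 * exp (- N * min (t\<^sup>2 / (20736 * (K * \<gamma>)\<^sup>2)) (t / (144 * (K * \<gamma>))))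
     + 2 * (if L2_set v I = 0 then (if t > 0 then 0 else 1)
            else exp (- (N\<^sup>2 * t\<^sup>2 / (2304 * K * (1 + \<gamma>)\<^sup>2 * (L2_set v I)\<^sup>2))))"
proof -
  interpret averaging_matrix I a \<gamma> by fact
  interpret iid: prob_space "iid I" by (rule prob_space_iid)
  define X where "X e = (\<Sum>i\<in>I. lin v i * e i)" for e
  define Y where "Y e = (\<Sum>i\<in>I. gram i i * ((e i)\<^sup>2 - sigma2))" for e
  define Z where "Z e = (\<Sum>i\<in>I. \<Sum>j\<in>I-{i}. form i j * (e i * e j))" for e
  have meas[measurable]: "X \<in> borel_measurable (iid I)" "Y \<in> borel_measurable (iid I)" "Z \<in> borel_measurable (iid I)"
    unfolding X_def Y_def Z_def
    by (intro borel_measurable_sum borel_measurable_times borel_measurable_diff borel_measurable_power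
        borel_measurable_const measurable_iid_component, auto)+
  have dec: "residual_ss I a (\<lambda>i. v i + e i) - (\<Sum>i\<in>I. (e i)\<^sup>2) - risk I a v = X e + Y e + Z e" for e
  proof -
    have "(\<Sum>i\<in>I. \<Sum>j\<in>I. (a i j)\<^sup>2) = (\<Sum>i\<in>I. gram i i)"
      unfolding gram_def by (subst sum.swap) (simp add: power2_eq_square)
    then show ?thesis
      by (simp add: residual_ss_add risk_def X_def Y_def Z_def right_diff_distrib sum_subtractf
          sum_distrib_left sum_distrib_right mult.commute)
  qed
  define b where "b = min (t\<^sup>2 / (20736 * (K * \<gamma>)\<^sup>2)) (t / (144 * (K * \<gamma>)))"
  have Kg: "K * \<gamma> > 0" using K_pos gamma_ge_1 by simp
  have Z: "measure (iid I) {e \<in> space (iid I). N * (t/6) \<le> \<bar>Z e\<bar>} \<le> 2 * exp (- N * b)"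
  proof -
    have "(t/6)\<^sup>2 / (64 * (K * (3 * \<gamma>))\<^sup>2) = t\<^sup>2 / (20736 * (K * \<gamma>)\<^sup>2)"
      "(t/6) / (8 * (K * (3 * \<gamma>))) = t / (144 * (K * \<gamma>))"
      by (simp_all add: power_mult_distrib power_divide)
    then show ?thesis
      using tail_off_diagonal[OF finite_I _ _ form_bound, of "t/6"] t gamma_ge_1
      by (simp add: Z_def N_def b_def)
  qed
  have Y: "measure (iid I) {e \<in> space (iid I). N * (t/6) \<le> \<bar>Y e\<bar>} \<le> 2 * exp (- N * b)"
  proof -
    have "measure (iid I) {e \<in> space (iid I). N * (t/6) \<le> \<bar>Y e\<bar>}
      \<le> 2 * exp (- N * min ((t/6)\<^sup>2 / (4 * (K * \<gamma>)\<^sup>2)) ((t/6) / (2 * (K * \<gamma>))))"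
      unfolding N_def Y_def using t gamma_ge_1
      by (intro tail_diagonal finite_I gram_diag_bounds) auto
    moreover have "b \<le> min ((t/6)\<^sup>2 / (4 * (K * \<gamma>)\<^sup>2)) ((t/6) / (2 * (K * \<gamma>)))"
      unfolding b_def using Kg K_pos gamma_ge_1 t
      by (intro min.mono) (auto simp: power_divide intro!: divide_left_mono)
    then have "exp (- N * min ((t/6)\<^sup>2 / (4 * (K * \<gamma>)\<^sup>2)) ((t/6) / (2 * (K * \<gamma>)))) \<le> exp (- N * b)"
      by (simp add: N_def mult_left_mono)
    ultimately show ?thesis by linarith
  qed
  have X: "measure (iid I) {e \<in> space (iid I). N * (t/6) \<le> \<bar>X e\<bar>}
    \<le> 2 * (if L2_set v I = 0 then (if t > 0 then 0 else 1)
            else exp (- (N\<^sup>2 * t\<^sup>2 / (2304 * K * (1 + \<gamma>)\<^sup>2 * (L2_set v I)\<^sup>2))))"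
  proof (cases "L2_set v I = 0")
    case True
    then have "(\<Sum>j\<in>I. (lin v j)\<^sup>2) \<le> 0"
      using lin_bound[of v] by (simp add: L2_set_def)
    then have "(\<Sum>j\<in>I. (lin v j)\<^sup>2) = 0" by (intro antisym sum_nonneg) auto
    then have "\<forall>j\<in>I. lin v j = 0" using finite_I by (simp add: sum_nonneg_eq_0_iff)
    then have "X e = 0" for e by (simp add: X_def)
    moreover have "N > 0" using finite_I nonempty_I by (auto simp: N_def card_gt_0_iff)
    ultimately show ?thesis using True t by (auto simp: mult_le_0_iff iid.prob_space)
  next
    case False
    have L2: "(L2_set v I)\<^sup>2 = (\<Sum>i\<in>I. (v i)\<^sup>2)" by (simp add: L2_set_def sum_nonneg)
    have "measure (iid I) {e \<in> space (iid I). N * (t/6) \<le> \<bar>X e\<bar>}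
      \<le> 2 * exp (- ((N * (t/6))\<^sup>2 / (4 * K * (16 * (1 + \<gamma>)\<^sup>2 * (L2_set v I)\<^sup>2))))"
      unfolding X_def
    proof (intro tail_linear finite_I)
      show "(\<Sum>j\<in>I. (lin v j)\<^sup>2) \<le> 16 * (1 + \<gamma>)\<^sup>2 * (L2_set v I)\<^sup>2"
        using lin_bound[of v] by (simp only: L2)
      show "0 < 16 * (1 + \<gamma>)\<^sup>2 * (L2_set v I)\<^sup>2" using False gamma_ge_1 by simp
      show "0 \<le> N * (t/6)" using t by (simp add: N_def)
    qed
    also have "(N * (t/6))\<^sup>2 / (4 * K * (16 * (1 + \<gamma>)\<^sup>2 * (L2_set v I)\<^sup>2))
        = N\<^sup>2 * t\<^sup>2 / (2304 * K * (1 + \<gamma>)\<^sup>2 * (L2_set v I)\<^sup>2)"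
      by (simp add: power_mult_distrib power_divide)
    finally show ?thesis using False by simp
  qed
  let ?E = "\<lambda>W. {e \<in> space (iid I). N * (t/6) \<le> \<bar>W e\<bar>}"
  have "measure (iid I) {e \<in> space (iid I). N * t / 2 \<le> \<bar>X e + Y e + Z e\<bar>}
      \<le> measure (iid I) ((?E X \<union> ?E Y) \<union> ?E Z)"
  proof (intro iid.finite_measure_mono subsetI)
    fix e assume e: "e \<in> {e \<in> space (iid I). N * t / 2 \<le> \<bar>X e + Y e + Z e\<bar>}"
    then have "N * t / 2 \<le> \<bar>X e + Y e + Z e\<bar>" by simp
    moreover have "\<bar>X e + Y e + Z e\<bar> \<le> \<bar>X e\<bar> + \<bar>Y e\<bar> + \<bar>Z e\<bar>" by linarith
    moreover have "N * (t/6) = N * t / 6" by simp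
    ultimately have "N * (t/6) \<le> \<bar>X e\<bar> \<or> N * (t/6) \<le> \<bar>Y e\<bar> \<or> N * (t/6) \<le> \<bar>Z e\<bar>"
      by linarith
    then show "e \<in> (?E X \<union> ?E Y) \<union> ?E Z" using e by blast
  qed auto
  also have "\<dots> \<le> (measure (iid I) (?E X) + measure (iid I) (?E Y)) + measure (iid I) (?E Z)"
    by (intro order_trans[OF measure_Un_le] add_right_mono measure_Un_le) auto
  finally show ?thesis using X Y Z unfolding dec b_def by linarith
qed

end

section \<open>Nearest-neighbor weights and tie-breaking\<close>

definition knn_weight ::
  "nat \<Rightarrow> (nat \<Rightarrow> 'a::metric_space) \<Rightarrow> (nat \<Rightarrow> real) \<Rightarrow> nat \<Rightarrow> nat \<Rightarrow> nat \<Rightarrow> real" where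
  "knn_weight n x u k i j = (if j \<in> knn_set n x u k i then 1 / real k else 0)"

lemma knn_est_eq_smooth: "knn_est n x u y k i = smooth {1..n} (knn_weight n x u k) y i"
proof -
  have "{1..n} \<inter> knn_set n x u k i = knn_set n x u k i" using knn_set_subset[of n x u k i] by auto
  then show ?thesis
    by (simp add: knn_est_def smooth_def knn_weight_def sum_distrib_left if_distrib[of "\<lambda>z. z * _"]
        sum.inter_restrict[symmetric] cong: if_cong)
qed

lemma averaging_matrix_knn_weight:
  fixes S :: "'a::euclidean_space set" and x :: "nat \<Rightarrow> 'a"
  assumes S: "cone_cover S"
    and u: "inj_on u {1..n}" and k: "k \<in> {1..n-1}"
  shows "averaging_matrix {1..n} (knn_weight n x u k) (real (card S + 2))"
proof
  show "(\<Sum>j\<in>{1..n}. knn_weight n x u k i j) = 1" if i: "i \<in> {1..n}" for i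
  proof -
    have "{1..n} \<inter> knn_set n x u k i = knn_set n x u k i" using knn_set_subset[of n x u k i] by auto
    then show ?thesis
      using card_knn_set[OF i, of k x u] k by (simp add: knn_weight_def sum.inter_restrict[symmetric])
  qed
  show "(\<Sum>i\<in>{1..n}. knn_weight n x u k i j) \<le> real (card S + 2)" if j: "j \<in> {1..n}" for j
  proof -
    have "(\<Sum>i\<in>{1..n}. knn_weight n x u k i j) = real (card {i \<in> {1..n}. j \<in> knn_set n x u k i}) / real k"
      by (simp add: knn_weight_def sum.inter_filter[symmetric])
    also have "\<dots> \<le> real ((card S + 2) * k) / real k"
      by (intro divide_right_mono of_nat_mono Stone_column_count S u j) auto
    also have "\<dots> = real (card S + 2)" using k by (simp only: of_nat_mult) simp
    finally show ?thesis .
  qed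
  show "knn_weight n x u k i i = 0" for i
    using knn_set_subset[of n x u k i] by (auto simp: knn_weight_def)
qed (use k in \<open>auto simp: knn_weight_def\<close>)

lemma measurable_tie_break_component:
  assumes "l \<in> {1..n}"
  shows "(\<lambda>u. u l) \<in> borel_measurable (tie_break n)"
proof -
  have "measurable (tie_break n) (uniform_measure lborel {0..1::real}) = borel_measurable (tie_break n)"
    by (intro measurable_cong_sets) simp_all
  then show ?thesis
    using measurable_component_singleton[OF assms, of "\<lambda>_. uniform_measure lborel {0..1::real}"]
    by (simp add: tie_break_def)
qed

lemma measurable_knn_weight:
  assumes "i \<in> {1..n}"
  shows "(\<lambda>u. knn_weight n x u k i j) \<in> borel_measurable (tie_break n)"
proof (cases "j \<in> {1..n} - {i}")
  case True
  let ?S = "{1..n} - {i}"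
  have near: "Measurable.pred (tie_break n) (\<lambda>u. nearer x u i l j)" if "l \<in> ?S" for l
  proof -
    have "(\<lambda>u. u l) \<in> borel_measurable (tie_break n)" "(\<lambda>u. u i) \<in> borel_measurable (tie_break n)"
      "(\<lambda>u. u j) \<in> borel_measurable (tie_break n)"
      using that True assms by (auto intro: measurable_tie_break_component)
    then have "(\<lambda>u. \<bar>u l - u i\<bar>) \<in> borel_measurable (tie_break n)"
      "(\<lambda>u. \<bar>u j - u i\<bar>) \<in> borel_measurable (tie_break n)" by simp_all
    moreover have "Measurable.pred M (\<lambda>u. p \<or> q \<and> (f u < g u \<or> f u = g u \<and> r))"
      if [measurable]: "f \<in> borel_measurable M" "g \<in> borel_measurable M"
      for M :: "(nat \<Rightarrow> real) measure" and f g :: "(nat \<Rightarrow> real) \<Rightarrow> real" and p q r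
    proof -
      have "(p \<or> q \<and> (f u < g u \<or> f u = g u \<and> r)) \<longleftrightarrow> (p \<or> q \<and> (f u < g u \<or> \<not> g u < f u \<and> r))" for u
        by auto
      then show ?thesis by simp
    qed
    ultimately show ?thesis unfolding nearer_def by blast
  qed
  have "knn_weight n x u k i j
    = (if (\<Sum>l\<in>?S. if nearer x u i l j then 1 else 0 :: real) < real k then 1 / real k else 0)" for u
  proof -
    have "(\<Sum>l\<in>?S. if nearer x u i l j then 1 else 0 :: real) = real (card {l \<in> ?S. nearer x u i l j})"
      by (simp add: sum.inter_filter[symmetric])
    then show ?thesis using True by (simp add: knn_weight_def knn_set_def)
  qed
  moreover have "(\<lambda>u. \<Sum>l\<in>?S. if nearer x u i l j then 1 else 0 :: real) \<in> borel_measurable (tie_break n)"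
    by (intro borel_measurable_sum measurable_If predE[OF near] borel_measurable_const)
  ultimately show ?thesis by simp
next
  case False
  then have "knn_weight n x u k i j = 0" for u
    using knn_set_subset[of n x u k i] by (auto simp: knn_weight_def)
  then show ?thesis by simp
qed

lemma prob_space_uniform01: "prob_space (uniform_measure lborel {0..1::real})"
  by (rule prob_space_uniform_measure) auto

text \<open>
  Integrating over the \<open>i\<close>-th coordinate first leaves the uniform mass of a single point.
\<close>

lemma AE_tie_break_neq:
  assumes ij: "i \<in> {1..n}" "j \<in> {1..n}" "i \<noteq> j"
  shows "AE u in tie_break n. u i \<noteq> u j"
proof -
  let ?U = "uniform_measure lborel {0..1::real}"
  interpret U: prob_space ?U by (rule prob_space_uniform01)
  interpret product_sigma_finite "\<lambda>_::nat. ?U"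
    by (intro product_sigma_finite.intro U.sigma_finite_measure_axioms)
  define I where "I = {1..n} - {i}"
  have ins: "insert i I = {1..n}" using ij by (auto simp: I_def)
  have c: "(\<lambda>u. u l) \<in> borel_measurable (tie_break n)" if "l \<in> {1..n}" for l
    by (rule measurable_tie_break_component[OF that])
  have sets: "{u \<in> space (tie_break n). u i = u j} \<in> sets (tie_break n)"
    using c[OF ij(1)] c[OF ij(2)] by measurable
  have "emeasure (tie_break n) {u \<in> space (tie_break n). u i = u j}
      = (\<integral>\<^sup>+u. indicator {u \<in> space (tie_break n). u i = u j} u \<partial>tie_break n)"
    using sets by simp
  also have "\<dots> \<le> (\<integral>\<^sup>+u. indicator {0} (u i - u j) \<partial>tie_break n)"
    by (intro nn_integral_mono) (auto simp: indicator_def)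
  also have "\<dots> = (\<integral>\<^sup>+u. (\<integral>\<^sup>+y. indicator {0} ((u(i := y)) i - (u(i := y)) j) \<partial>?U) \<partial>Pi\<^sub>M I (\<lambda>_. ?U))"
  proof -
    have "(\<lambda>u. indicator {0} (u i - u j) :: ennreal) \<in> borel_measurable (Pi\<^sub>M (insert i I) (\<lambda>_. ?U))"
      using c[OF ij(1)] c[OF ij(2)] unfolding ins tie_break_def[symmetric] by measurable
    then show ?thesis
      unfolding tie_break_def ins[symmetric] by (intro product_nn_integral_insert) (auto simp: I_def)
  qed
  also have "\<dots> = (\<integral>\<^sup>+u. 0 \<partial>Pi\<^sub>M I (\<lambda>_. ?U))"
  proof (rule nn_integral_cong)
    fix u :: "nat \<Rightarrow> real"
    have "(\<integral>\<^sup>+y. indicator {0} ((u(i := y)) i - (u(i := y)) j) \<partial>?U) = (\<integral>\<^sup>+y. indicator {u j} y \<partial>?U)"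
      using ij(3) by (intro nn_integral_cong) (auto simp: indicator_def)
    also have "\<dots> = emeasure ?U {u j}" by simp
    also have "\<dots> = 0"
    proof -
      have "emeasure lborel ({0..1} \<inter> {u j}) \<le> emeasure lborel {u j}" by (intro emeasure_mono) auto
      then show ?thesis by (simp add: emeasure_uniform_measure)
    qed
    finally show "(\<integral>\<^sup>+y. indicator {0} ((u(i := y)) i - (u(i := y)) j) \<partial>?U) = 0" .
  qed
  finally have "emeasure (tie_break n) {u \<in> space (tie_break n). u i = u j} = 0" by simp
  then show ?thesis using sets by (intro AE_I'[of "{u \<in> space (tie_break n). u i = u j}"]) auto
qed

lemma AE_tie_break_inj: "AE u in tie_break n. inj_on u {1..n}"
proof -
  have "AE u in tie_break n. \<forall>i\<in>{1..n}. \<forall>j\<in>{1..n}. i \<noteq> j \<longrightarrow> u i \<noteq> u j"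
    by (intro AE_finite_allI) (auto intro: AE_tie_break_neq)
  then show ?thesis by (rule AE_mp) (auto simp: inj_on_def)
qed

section \<open>Cross-validation\<close>

context sub_gaussian_law begin

lemma MSE_eq_risk:
  "MSE n x m D u k = risk {1..n} (knn_weight n x u k) (\<lambda>i. m (x i)) / real n"
  using expected_loss_eq_risk[of "{1..n}" "\<lambda>i. m (x i)" "knn_weight n x u k"]
  by (simp add: MSE_def noise_def knn_est_eq_smooth response_def[abs_def])

lemma loo_cv_eq_residual_ss: "loo_cv n x u y k = residual_ss {1..n} (knn_weight n x u k) y / real n"
  by (simp add: loo_cv_def residual_ss_def knn_est_eq_smooth)

text \<open>
  Scaled by \<open>n\<close>, this is the gap between the criterion and the mean squared error after removal of the
  noise energy, which does not depend on \<open>k\<close>.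
\<close>

definition cv_deviation :: "nat \<Rightarrow> (nat \<Rightarrow> 'a::metric_space) \<Rightarrow> ('a \<Rightarrow> real) \<Rightarrow> (nat \<Rightarrow> real) \<Rightarrow> (nat \<Rightarrow> real) \<Rightarrow> nat \<Rightarrow> real" where
  "cv_deviation n x m e u k = residual_ss {1..n} (knn_weight n x u k) (\<lambda>i. m (x i) + e i)
     - (\<Sum>i=1..n. (e i)\<^sup>2) - risk {1..n} (knn_weight n x u k) (\<lambda>i. m (x i))"

text \<open>
  As \<open>kt\<close> minimizes the criterion, \<open>MSE kt - MSE ks\<close> is at most the difference of the deviations at \<open>ks\<close> and
  \<open>kt\<close>; the noise energy cancels, and one of the two deviations carries half of the excess.
\<close>

lemma excess_risk_deviation:
  assumes n: "n \<ge> 2"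
    and ks: "is_arg_min (MSE n x m D u) (\<lambda>k. k \<in> {1..n-1}) ks"
    and kt: "is_arg_min (loo_cv n x u (response m x e)) (\<lambda>k. k \<in> {1..n-1}) kt"
    and t: "t \<le> \<bar>MSE n x m D u ks - MSE n x m D u kt\<bar>"
  shows "\<exists>k\<in>{1..n-1}. real n * t / 2 \<le> \<bar>cv_deviation n x m e u k\<bar>"
proof -
  have k: "ks \<in> {1..n-1}" "kt \<in> {1..n-1}" using ks kt by (auto simp: is_arg_min_def)
  have le: "MSE n x m D u ks \<le> MSE n x m D u kt"
    "loo_cv n x u (response m x e) kt \<le> loo_cv n x u (response m x e) ks"
    using ks kt k by (auto simp: is_arg_min_linorder)
  let ?g = "cv_deviation n x m e u"
  have "real n * (loo_cv n x u (response m x e) k - MSE n x m D u k) = ?g k + (\<Sum>i=1..n. (e i)\<^sup>2)" for k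
    using n by (simp add: loo_cv_eq_residual_ss MSE_eq_risk cv_deviation_def response_def[abs_def] field_simps)
  from this[of ks] this[of kt]
  have "real n * (MSE n x m D u kt - MSE n x m D u ks)
     = ?g ks - ?g kt + real n * (loo_cv n x u (response m x e) kt - loo_cv n x u (response m x e) ks)"
    by (simp add: algebra_simps)
  also have "\<dots> \<le> ?g ks - ?g kt" using le(2) by (simp add: mult_le_0_iff)
  finally have "real n * (MSE n x m D u kt - MSE n x m D u ks) \<le> ?g ks - ?g kt" .
  moreover have "real n * t \<le> real n * (MSE n x m D u kt - MSE n x m D u ks)"
    using t le(1) by (intro mult_left_mono) auto
  ultimately have "real n * t / 2 \<le> \<bar>?g ks\<bar> \<or> real n * t / 2 \<le> \<bar>?g kt\<bar>" by linarith
  then show ?thesis using k by blast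
qed

lemma measurable_cv_deviation:
  "(\<lambda>p. cv_deviation n x m (fst p) (snd p) k) \<in> borel_measurable (sample n D)"
proof -
  have w: "(\<lambda>p. knn_weight n x (snd p) k i j) \<in> borel_measurable (sample n D)" if "i \<in> {1..n}" for i j
    unfolding sample_def by (rule measurable_compose[OF measurable_snd measurable_knn_weight[OF that]])
  have e: "(\<lambda>p. fst p i) \<in> borel_measurable (sample n D)" if "i \<in> {1..n}" for i
    unfolding sample_def noise_def
    by (rule measurable_compose[OF measurable_fst measurable_iid_component[OF that]])
  have sm: "(\<lambda>p. smooth {1..n} (knn_weight n x (snd p) k) (f p) i) \<in> borel_measurable (sample n D)"
    if i: "i \<in> {1..n}" and f: "\<And>j. j \<in> {1..n} \<Longrightarrow> (\<lambda>p. f p j) \<in> borel_measurable (sample n D)" for f i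
    unfolding smooth_def
    by (rule borel_measurable_sum, rule borel_measurable_times, rule w[OF i], rule f)
  have y: "(\<lambda>p. m (x i) + fst p i) \<in> borel_measurable (sample n D)" if "i \<in> {1..n}" for i
    using e[OF that] by simp
  have "(\<lambda>p. (m (x i) + fst p i - smooth {1..n} (knn_weight n x (snd p) k) (\<lambda>i. m (x i) + fst p i) i)\<^sup>2)
      \<in> borel_measurable (sample n D)" if "i \<in> {1..n}" for i
    using y[OF that] sm[OF that y] by (rule borel_measurable_power[OF borel_measurable_diff])
  then have r1: "(\<lambda>p. residual_ss {1..n} (knn_weight n x (snd p) k) (\<lambda>i. m (x i) + fst p i)) \<in> borel_measurable (sample n D)"
    unfolding residual_ss_def by (rule borel_measurable_sum)
  have "(\<lambda>p. (m (x i) - smooth {1..n} (knn_weight n x (snd p) k) (\<lambda>i. m (x i)) i)\<^sup>2)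
      \<in> borel_measurable (sample n D)" if "i \<in> {1..n}" for i
    using borel_measurable_const sm[OF that borel_measurable_const] by (rule borel_measurable_power[OF borel_measurable_diff])
  then have r2: "(\<lambda>p. residual_ss {1..n} (knn_weight n x (snd p) k) (\<lambda>i. m (x i))) \<in> borel_measurable (sample n D)"
    unfolding residual_ss_def by (rule borel_measurable_sum)
  have q: "(\<lambda>p. \<Sum>i\<in>{1..n}. \<Sum>j\<in>{1..n}. (knn_weight n x (snd p) k i j)\<^sup>2) \<in> borel_measurable (sample n D)"
    by (rule borel_measurable_sum, rule borel_measurable_sum, rule borel_measurable_power, rule w)
  have e2: "(\<lambda>p. \<Sum>i\<in>{1..n}. (fst p i)\<^sup>2) \<in> borel_measurable (sample n D)"
    by (rule borel_measurable_sum, rule borel_measurable_power, rule e)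
  show ?thesis
    unfolding cv_deviation_def risk_def
    by (rule borel_measurable_diff[OF borel_measurable_diff[OF r1 e2]
          borel_measurable_add[OF r2 borel_measurable_times[OF borel_measurable_const q]]])
qed

lemma prob_space_tie_break: "prob_space (tie_break n)"
  unfolding tie_break_def by (intro prob_space_PiM prob_space_uniform01)

text \<open>
  For fixed tie-breaking variables the matrix is deterministic, so the bound follows from a union
  bound over \<open>k\<close>; Fubini's theorem then integrates over the tie-breaking variables, discarding the null set on
  which they are not distinct.
\<close>

lemma max_cv_deviation_tail:
  fixes S :: "'a::euclidean_space set" and x :: "nat \<Rightarrow> 'a" and m :: "'a \<Rightarrow> real" and n :: nat
  assumes S: "cone_cover S" and t: "t \<ge> 0"
  defines "\<gamma> \<equiv> real (card S + 2)" and "mu \<equiv> L2_set (\<lambda>i. m (x i)) {1..n}"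
  shows "measure (sample n D) {p \<in> space (sample n D). \<exists>k\<in>{1..n-1}. real n * t / 2 \<le> \<bar>cv_deviation n x m (fst p) (snd p) k\<bar>}
    \<le> 4 * real n * exp (- real n * min (t\<^sup>2 / (20736 * (K * \<gamma>)\<^sup>2)) (t / (144 * (K * \<gamma>))))
     + 4 * real n * (if mu = 0 then (if t > 0 then 0 else 1)
            else exp (- ((real n)\<^sup>2 * t\<^sup>2 / (2304 * K * (1 + \<gamma>)\<^sup>2 * mu\<^sup>2))))"
    (is "measure _ ?G \<le> ?B")
proof -
  interpret N: prob_space "noise n D" unfolding noise_def by (rule prob_space_iid)
  interpret T: prob_space "tie_break n" by (rule prob_space_tie_break)
  interpret P: pair_prob_space "noise n D" "tie_break n" ..
  define b1 where "b1 = exp (- real n * min (t\<^sup>2 / (20736 * (K * \<gamma>)\<^sup>2)) (t / (144 * (K * \<gamma>))))"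
  define b2 where "b2 = (if mu = 0 then (if t > 0 then 0 else 1)
            else exp (- ((real n)\<^sup>2 * t\<^sup>2 / (2304 * K * (1 + \<gamma>)\<^sup>2 * mu\<^sup>2))))"
  have b: "b1 \<ge> 0" "b2 \<ge> 0" by (auto simp: b1_def b2_def)
  have B: "?B = 4 * real n * b1 + 4 * real n * b2" unfolding b1_def b2_def ..
  have [measurable]: "(\<lambda>p. cv_deviation n x m (fst p) (snd p) k) \<in> borel_measurable (sample n D)" for k
    by (rule measurable_cv_deviation)
  have G: "?G \<in> sets (sample n D)" by measurable
  have slice: "emeasure (noise n D) ((\<lambda>e. (e, u)) -` ?G) \<le> ennreal ?B"
    if u: "inj_on u {1..n}" "u \<in> space (tie_break n)" for u
  proof -
    let ?E = "\<lambda>k. {e \<in> space (noise n D). real n * t / 2 \<le> \<bar>cv_deviation n x m e u k\<bar>}"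
    have E: "?E k \<in> sets (noise n D)" for k
    proof -
      have "(\<lambda>e. cv_deviation n x m e u k) \<in> borel_measurable (noise n D)"
        using measurable_compose[OF measurable_Pair2'[OF u(2)] measurable_cv_deviation[of n x m k, unfolded sample_def]]
        by simp
      then show ?thesis by measurable
    qed
    have "(\<lambda>e. (e, u)) -` ?G = (\<Union>k\<in>{1..n-1}. ?E k)"
      using u(2) by (auto simp: sample_def space_pair_measure)
    then have "emeasure (noise n D) ((\<lambda>e. (e, u)) -` ?G) = ennreal (measure (noise n D) (\<Union>k\<in>{1..n-1}. ?E k))"
      by (simp add: N.emeasure_eq_measure)
    also have "measure (noise n D) (\<Union>k\<in>{1..n-1}. ?E k) \<le> (\<Sum>k\<in>{1..n-1}. measure (noise n D) (?E k))"
      using E by (intro N.finite_measure_subadditive_finite) auto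
    also have "\<dots> \<le> (\<Sum>k\<in>{1..n-1}. 4 * b1 + 2 * b2)"
    proof (rule sum_mono)
      fix k assume "k \<in> {1..n-1}"
      then have "averaging_matrix {1..n} (knn_weight n x u k) \<gamma>"
        unfolding \<gamma>_def by (rule averaging_matrix_knn_weight[OF S u(1)])
      from residual_ss_concentration[OF this t, of "\<lambda>i. m (x i)"]
      show "measure (noise n D) (?E k) \<le> 4 * b1 + 2 * b2"
        unfolding noise_def cv_deviation_def b1_def b2_def mu_def card_atLeastAtMost diff_Suc_1 .
    qed
    also have "\<dots> = real (n - 1) * (4 * b1 + 2 * b2)" by simp
    also have "\<dots> \<le> real n * (4 * b1 + 4 * b2)" using b by (intro mult_mono) auto
    also have "\<dots> = ?B" unfolding B by (simp add: algebra_simps)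
    finally show ?thesis by (simp only: ennreal_leI)
  qed
  have "emeasure (sample n D) ?G = (\<integral>\<^sup>+u. emeasure (noise n D) ((\<lambda>e. (e, u)) -` ?G) \<partial>tie_break n)"
    using G unfolding sample_def by (rule P.emeasure_pair_measure_alt2)
  also have "\<dots> \<le> (\<integral>\<^sup>+u. ennreal ?B \<partial>tie_break n)"
  proof (rule nn_integral_mono_AE)
    show "AE u in tie_break n. emeasure (noise n D) ((\<lambda>e. (e, u)) -` ?G) \<le> ennreal ?B"
      using AE_tie_break_inj[of n] AE_space[of "tie_break n"] by eventually_elim (rule slice)
  qed
  also have "\<dots> = ennreal ?B" by (simp add: T.emeasure_space_1)
  finally have "emeasure (sample n D) ?G \<le> ennreal ?B" .
  moreover have "?B \<ge> 0" unfolding B using b by simp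
  ultimately show ?thesis unfolding measure_def by (intro enn2real_leI)
qed

end

theorem theorem2p1:
  fixes K :: real
  assumes "K > 0"
  shows "\<exists>A B C :: real. A > 0 \<and> B > 0 \<and> C > 0 \<and>
    (\<forall>(n :: nat) (x :: nat \<Rightarrow> real ^ 'd) (m :: real ^ 'd \<Rightarrow> real) (D :: real measure)
       (kstar :: (nat \<Rightarrow> real) \<Rightarrow> nat) (ktilde :: (nat \<Rightarrow> real) \<times> (nat \<Rightarrow> real) \<Rightarrow> nat) (t :: real).
      n \<ge> 2 \<longrightarrow>
      m \<in> borel_measurable borel \<longrightarrow>
      prob_space D \<longrightarrow> sets D = sets borel \<longrightarrow>
      integrable D (\<lambda>e. e) \<longrightarrow> (\<integral>e. e \<partial>D) = 0 \<longrightarrow>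
      (\<integral>\<^sup>+e. ennreal (exp (e\<^sup>2 / K)) \<partial>D) \<le> 2 \<longrightarrow>
      (\<forall>u\<in>space (tie_break n). is_arg_min (MSE n x m D u) (\<lambda>k. k \<in> {1..n-1}) (kstar u)) \<longrightarrow>
      (\<forall>(e, u)\<in>space (sample n D).
         is_arg_min (loo_cv n x u (response m x e)) (\<lambda>k. k \<in> {1..n-1}) (ktilde (e, u))) \<longrightarrow>
      ktilde \<in> measurable (sample n D) (count_space UNIV) \<longrightarrow>
      t \<ge> 0 \<longrightarrow>
      measure (sample n D)
        {(e, u) \<in> space (sample n D). \<bar>MSE n x m D u (kstar u) - MSE n x m D u (ktilde (e, u))\<bar> \<ge> t}
      \<le> 4 * real n * exp (- real n * min (A * t\<^sup>2) (B * t)) +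
        4 * real n *
          (let mu = L2_set (\<lambda>i. m (x i)) {1..n}
           in if mu = 0 then (if t > 0 then 0 else 1)
              else exp (- C * (real n)\<^sup>2 * t\<^sup>2 / mu\<^sup>2)))"
proof -
  obtain S :: "(real ^ 'd) set" where S: "cone_cover S" by (rule ex_cone_cover)
  define \<gamma> where "\<gamma> = real (card S + 2)"
  have pos: "K * \<gamma> > 0" "\<gamma> > 0" using assms by (simp_all add: \<gamma>_def)
  show ?thesis
  proof (rule exI[of _ "1 / (20736 * (K * \<gamma>)\<^sup>2)"], rule exI[of _ "1 / (144 * (K * \<gamma>))"],
      rule exI[of _ "1 / (2304 * K * (1 + \<gamma>)\<^sup>2)"], intro conjI allI impI)
    show "1 / (20736 * (K * \<gamma>)\<^sup>2) > 0" "1 / (144 * (K * \<gamma>)) > 0" "1 / (2304 * K * (1 + \<gamma>)\<^sup>2) > 0"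
      using pos assms by (auto intro!: divide_pos_pos mult_pos_pos)
    fix n :: nat and x :: "nat \<Rightarrow> real ^ 'd" and m :: "real ^ 'd \<Rightarrow> real" and D :: "real measure"
      and kstar :: "(nat \<Rightarrow> real) \<Rightarrow> nat" and ktilde :: "(nat \<Rightarrow> real) \<times> (nat \<Rightarrow> real) \<Rightarrow> nat" and t :: real
    assume n: "n \<ge> 2" and "m \<in> borel_measurable borel" and D: "prob_space D" "sets D = sets borel"
      "integrable D (\<lambda>e. e)" "(\<integral>e. e \<partial>D) = 0" "(\<integral>\<^sup>+e. ennreal (exp (e\<^sup>2 / K)) \<partial>D) \<le> 2"
      and ks: "\<forall>u\<in>space (tie_break n). is_arg_min (MSE n x m D u) (\<lambda>k. k \<in> {1..n-1}) (kstar u)"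
      and kt: "\<forall>(e, u)\<in>space (sample n D).
         is_arg_min (loo_cv n x u (response m x e)) (\<lambda>k. k \<in> {1..n-1}) (ktilde (e, u))"
      and "ktilde \<in> measurable (sample n D) (count_space UNIV)" and t: "t \<ge> 0"
    interpret sub_gaussian_law D K
      using D assms by (intro sub_gaussian_law.intro sub_gaussian_law_axioms.intro)
    interpret Smp: prob_space "sample n D"
      unfolding sample_def noise_def
      by (intro prob_space_pair prob_space_iid prob_space_tie_break)
    \<comment> \<open>The event of interest lies in \<open>?G\<close>, which does not involve the minimizers and is measurable.\<close>
    let ?G = "{p \<in> space (sample n D). \<exists>k\<in>{1..n-1}. real n * t / 2 \<le> \<bar>cv_deviation n x m (fst p) (snd p) k\<bar>}"
    have [measurable]: "(\<lambda>p. cv_deviation n x m (fst p) (snd p) k) \<in> borel_measurable (sample n D)" for k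
      by (rule measurable_cv_deviation)
    have "measure (sample n D)
        {(e, u) \<in> space (sample n D). \<bar>MSE n x m D u (kstar u) - MSE n x m D u (ktilde (e, u))\<bar> \<ge> t}
      \<le> measure (sample n D) ?G"
    proof (rule Smp.finite_measure_mono)
      have "(e, u) \<in> ?G" if p: "(e, u) \<in> space (sample n D)"
        and dev: "t \<le> \<bar>MSE n x m D u (kstar u) - MSE n x m D u (ktilde (e, u))\<bar>" for e u
      proof -
        have "u \<in> space (tie_break n)" using p by (simp add: sample_def space_pair_measure)
        then show ?thesis using excess_risk_deviation[OF n _ _ dev, of e] ks kt p by auto
      qed
      then show "{(e, u) \<in> space (sample n D). \<bar>MSE n x m D u (kstar u) - MSE n x m D u (ktilde (e, u))\<bar> \<ge> t} \<subseteq> ?G"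
        by (intro subsetI) (simp only: mem_Collect_eq split_paired_all prod.case)
      show "?G \<in> sets (sample n D)" by measurable
    qed
    also have "\<dots> \<le> 4 * real n * exp (- real n * min (1 / (20736 * (K * \<gamma>)\<^sup>2) * t\<^sup>2) (1 / (144 * (K * \<gamma>)) * t)) +
        4 * real n *
          (let mu = L2_set (\<lambda>i. m (x i)) {1..n}
           in if mu = 0 then (if t > 0 then 0 else 1)
              else exp (- (1 / (2304 * K * (1 + \<gamma>)\<^sup>2)) * (real n)\<^sup>2 * t\<^sup>2 / mu\<^sup>2))"
    proof -
      have e1: "1 / c * z = z / c" and e2: "- (1 / c) * p * q / z = - (p * q / (c * z))" for c p q z :: real
        by simp_all
      show ?thesis
        unfolding Let_def e1 e2 by (rule max_cv_deviation_tail[OF S t, folded \<gamma>_def])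
    qed
    finally show "measure (sample n D)
        {(e, u) \<in> space (sample n D). \<bar>MSE n x m D u (kstar u) - MSE n x m D u (ktilde (e, u))\<bar> \<ge> t}
      \<le> 4 * real n * exp (- real n * min (1 / (20736 * (K * \<gamma>)\<^sup>2) * t\<^sup>2) (1 / (144 * (K * \<gamma>)) * t)) +
        4 * real n *
          (let mu = L2_set (\<lambda>i. m (x i)) {1..n}
           in if mu = 0 then (if t > 0 then 0 else 1)
              else exp (- (1 / (2304 * K * (1 + \<gamma>)\<^sup>2)) * (real n)\<^sup>2 * t\<^sup>2 / mu\<^sup>2))" .
  qed
qed

end
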